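(* Let $m \geq 1$ be an integer and let $q$ be an odd prime power. Let $G$ be one of the finite simple groups $G=\Omega^-(4m+2,q)$ with $q\equiv 1 \pmod 4$, or $G=\Omega^+(4m+2,q)$ with $q \equiv 3 \pmod 4$. Then all real conjugacy classes of $G$ are strongly real.
   Context: Let $q$ be an odd prime power and let $V=\mathbb{F}_q^n$ carry a quadratic form $Q$ with associated non-degenerate symmetric bilinear form $B$, so $Q(u+v)=Q(u)+2B(u,v)+Q(v)$. The orthogonal group is the group of isometries of $Q$. For even $n=2k$ there are two equivalence classes of such forms: the split ($+$-type) form, equivalent to $x_1x_2+x_3x_4+\cdots+x_{2k-1}x_{2k}$, and the non-split ($-$-type) form; the corresponding orthogonal groups are $\mathrm{O}^{+}(n,q)$ and $\mathrm{O}^{-}(n,q)$. The group $\Omega^{\pm}(n,q)$ is the derived (commutator) subgroup of $\mathrm{O}^{\pm}(n,q)$. An element $g$ of a finite group $G$ is real in $G$ if there is $h\in G$ with $hgh^{-1}=g^{-1}$; it is strongly real in $G$ if there is $s\in G$ with $s^2=1$ and $sgs^{-1}=g^{-1}$. A conjugacy class is real (strongly real) if its elements are. *)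

theory Defs
  imports "HOL-Analysis.Cartesian_Space" "HOL-Algebra.Generated_Groups"
begin

definition is_real_in :: "('g, 'b) monoid_scheme \<Rightarrow> 'g \<Rightarrow> bool" where
  "is_real_in G g \<longleftrightarrow>
     (\<exists>h\<in>carrier G. h \<otimes>\<^bsub>G\<^esub> g \<otimes>\<^bsub>G\<^esub> inv\<^bsub>G\<^esub> h = inv\<^bsub>G\<^esub> g)"

definition is_strongly_real_in :: "('g, 'b) monoid_scheme \<Rightarrow> 'g \<Rightarrow> bool" where
  "is_strongly_real_in G g \<longleftrightarrow>
     (\<exists>s\<in>carrier G. s [^]\<^bsub>G\<^esub> (2::nat) = \<one>\<^bsub>G\<^esub> \<and> s \<otimes>\<^bsub>G\<^esub> g \<otimes>\<^bsub>G\<^esub> inv\<^bsub>G\<^esub> s = inv\<^bsub>G\<^esub> g)"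

definition conjugacy_class :: "('g, 'b) monoid_scheme \<Rightarrow> 'g \<Rightarrow> 'g set" where
  "conjugacy_class G g = {h \<otimes>\<^bsub>G\<^esub> g \<otimes>\<^bsub>G\<^esub> inv\<^bsub>G\<^esub> h | h. h \<in> carrier G}"

definition conjugacy_classes :: "('g, 'b) monoid_scheme \<Rightarrow> 'g set set" where
  "conjugacy_classes G = conjugacy_class G ` carrier G"

definition real_class :: "('g, 'b) monoid_scheme \<Rightarrow> 'g set \<Rightarrow> bool" where
  "real_class G C \<longleftrightarrow> (\<forall>g\<in>C. is_real_in G g)"

definition strongly_real_class :: "('g, 'b) monoid_scheme \<Rightarrow> 'g set \<Rightarrow> bool" where
  "strongly_real_class G C \<longleftrightarrow> (\<forall>g\<in>C. is_strongly_real_in G g)"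

(* Normalised so that Q(u+v) = Q(u) + 2B(u,v) + Q(v).
   Meaningful only in odd characteristic, since 2 has to be invertible. *)
definition assoc_form :: "('a::field ^ 'n \<Rightarrow> 'a) \<Rightarrow> 'a ^ 'n \<Rightarrow> 'a ^ 'n \<Rightarrow> 'a" where
  "assoc_form Q u v = (Q (u + v) - Q u - Q v) / 2"

definition quadratic_form :: "('a::field ^ 'n \<Rightarrow> 'a) \<Rightarrow> bool" where
  "quadratic_form Q \<longleftrightarrow>
     (\<forall>c v. Q (c *s v) = c\<^sup>2 * Q v) \<and>
     (\<forall>u. Vector_Spaces.linear (*s) (*) (assoc_form Q u))"

definition nondegenerate :: "('a::field ^ 'n \<Rightarrow> 'a) \<Rightarrow> bool" where
  "nondegenerate Q \<longleftrightarrow> (\<forall>u. (\<forall>v. assoc_form Q u v = 0) \<longrightarrow> u = 0)"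

definition equivalent_forms :: "('a::field ^ 'n \<Rightarrow> 'a) \<Rightarrow> ('a ^ 'n \<Rightarrow> 'a) \<Rightarrow> bool" where
  "equivalent_forms Q Q' \<longleftrightarrow>
     (\<exists>T. Vector_Spaces.linear (*s) (*s) T \<and> bij T \<and> (\<forall>v. Q (T v) = Q' v))"

(* x_1 x_2 + x_3 x_4 + ... + x_(n-1) x_n for even n, where the enumeration e (from 0)
   of the index type says which coordinate is called x_(i+1). *)
definition hyperbolic_form :: "(nat \<Rightarrow> 'n) \<Rightarrow> 'a::field ^ 'n \<Rightarrow> 'a" where
  "hyperbolic_form e x = (\<Sum>i < CARD('n) div 2. x $ e (2 * i) * x $ e (2 * i + 1))"

(* The choice of e is immaterial: permuting coordinates is a linear bijection. *)
definition plus_type :: "('a::field ^ 'n::finite \<Rightarrow> 'a) \<Rightarrow> bool" where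
  "plus_type Q \<longleftrightarrow>
     even CARD('n) \<and> quadratic_form Q \<and> nondegenerate Q \<and>
     (\<exists>e. bij_betw e {..<CARD('n)} (UNIV :: 'n set) \<and> equivalent_forms Q (hyperbolic_form e))"

(* Over a finite field of odd order there are exactly two equivalence classes of
   non-degenerate forms in a given even dimension; this is the non-split one. *)
definition minus_type :: "('a::field ^ 'n::finite \<Rightarrow> 'a) \<Rightarrow> bool" where
  "minus_type Q \<longleftrightarrow>
     even CARD('n) \<and> quadratic_form Q \<and> nondegenerate Q \<and> \<not> plus_type Q"

definition orthogonal_group :: "('a::field ^ 'n \<Rightarrow> 'a) \<Rightarrow> ('a ^ 'n \<Rightarrow> 'a ^ 'n) monoid" where
  "orthogonal_group Q =
     \<lparr>carrier = {g. Vector_Spaces.linear (*s) (*s) g \<and> bij g \<and> (\<forall>v. Q (g v) = Q v)},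
      mult = (\<circ>), one = id\<rparr>"

definition Omega :: "('a::field ^ 'n \<Rightarrow> 'a) \<Rightarrow> ('a ^ 'n \<Rightarrow> 'a ^ 'n) monoid" where
  "Omega Q = (orthogonal_group Q)
     \<lparr>carrier := derived (orthogonal_group Q) (carrier (orthogonal_group Q))\<rparr>"

lemma group_orthogonal_group: "group (orthogonal_group Q)"
proof (rule groupI)
  fix g assume g: "g \<in> carrier (orthogonal_group Q)"
  then have lin: "Vector_Spaces.linear (*s) (*s) g" and b: "bij g" and Q: "\<And>v. Q (g v) = Q v"
    by (auto simp: orthogonal_group_def)
  interpret g: Vector_Spaces.linear "(*s)" "(*s)" g by (fact lin)
  have gi: "g (inv_into UNIV g x) = x" for x
    using b by (simp add: bij_is_surj surj_f_inv_f)
  have ig: "inv_into UNIV g (g x) = x" for x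
    using b by (simp add: bij_is_inj)
  have "Vector_Spaces.linear (*s) (*s) (inv_into UNIV g)"
    by unfold_locales (metis g.add gi ig, metis g.scale gi ig)
  moreover have "Q (inv_into UNIV g v) = Q v" for v
    by (metis Q gi)
  moreover have "inv_into UNIV g \<circ> g = id"
    using ig by auto
  ultimately show "\<exists>h\<in>carrier (orthogonal_group Q).
      h \<otimes>\<^bsub>orthogonal_group Q\<^esub> g = \<one>\<^bsub>orthogonal_group Q\<^esub>"
    using b by (auto simp: orthogonal_group_def bij_imp_bij_inv intro!: exI[of _ "inv_into UNIV g"])
qed (auto simp: orthogonal_group_def o_assoc bij_comp vec.linear_id
      intro: Vector_Spaces.linear_compose)

lemma group_Omega: "group (Omega Q)"
  unfolding Omega_def
  by (intro subgroup.subgroup_is_group group.derived_is_subgroup group_orthogonal_group) simp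

end

theory Submission
  imports Defs "HOL-Analysis.Determinants" "HOL-Computational_Algebra.Polynomial"
begin

text \<open>
  Let \<open>O\<close> be the orthogonal group of the form, \<open>D\<close> its derived subgroup and \<open>n = 4 m + 2\<close> the
  dimension. Two independent facts carry the theorem.

  Up to sign, an isometry of determinant 1 lies in \<open>D\<close> (\<open>derived_or_minus_derived\<close>). In both cases
  of the theorem an orthogonal basis contains an odd number of vectors whose value under \<open>Q\<close> is a
  nonsquare, and, \<open>n\<close> being even, an odd number whose value is a square: if \<open>q = 1 mod 4\<close>, then
  \<open>-1\<close> is a square, two vectors with values in the same square class span a hyperbolic plane, and a
  basis with an even number of nonsquare values could be paired up into a split form; if
  \<open>q = 3 mod 4\<close>, then \<open>-1\<close> is a nonsquare and a hyperbolic plane has an orthogonal basis with values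
  \<open>1\<close> and \<open>-1\<close>, so the split form has \<open>2 m + 1\<close> nonsquare values. Now \<open>O\<close> is generated by
  reflections, and reflections in vectors of the same square class are conjugate in \<open>O\<close>. Hence
  \<open>O / D\<close> is generated by two elements \<open>\<alpha>\<close>, \<open>\<beta>\<close> with \<open>\<alpha>\<^sup>2 = \<beta>\<^sup>2 = 1\<close>, an isometry of determinant 1
  has class \<open>1\<close> or \<open>\<alpha> \<beta>\<close>, and \<open>-1\<close>, the product of the reflections in the basis, has class
  \<open>\<alpha> \<beta>\<close>. As \<open>s\<close> and \<open>-s\<close> are involutions at the same time and invert the same elements, only the
  determinant of an inverting involution has to be controlled.

  An isometry \<open>g\<close> that is inverted by an isometry \<open>h\<close> of determinant 1 is inverted by an involution
  of determinant 1 (\<open>special_inverting_involution\<close>). First, \<open>g\<close> is inverted by some involution (a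
  theorem of Wonenburger): with \<open>c = g + g\<^sup>-\<^sup>1\<close> and \<open>d = g - g\<^sup>-\<^sup>1\<close> it is enough to write the space
  as an orthogonal sum of \<open>X\<close> and \<open>Y\<close>, both invariant under \<open>c\<close> and exchanged by \<open>d\<close>, because then
  the map that is \<open>1\<close> on \<open>X\<close> and \<open>-1\<close> on \<open>Y\<close> commutes with \<open>c\<close> and anticommutes with \<open>d\<close>. As \<open>c\<close> is
  self-adjoint and \<open>d\<close> is skew-adjoint, this becomes a question about modules over the polynomials
  in \<open>c\<close>, answered by splitting off small orthogonal summands (\<open>nondegenerate_imp_gradable\<close>).
  Secondly, if the involution \<open>s\<close> so found has determinant \<open>-1\<close>, then \<open>z = s h\<close> commutes with \<open>g\<close>
  and has determinant \<open>-1\<close>. The involution \<open>t\<close> that is \<open>-1\<close> on the generalised eigenspace of \<open>z\<close>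
  for \<open>-1\<close> and \<open>1\<close> on its orthogonal complement commutes with \<open>g\<close>, and it also has determinant
  \<open>-1\<close>. Repeating the first construction on the two eigenspaces of \<open>t\<close> gives an inverting
  involution \<open>r\<close> that commutes with \<open>t\<close>, and one of \<open>r\<close> and \<open>r t\<close> has determinant 1.
\<close>

section \<open>Quadratic spaces\<close>

abbreviation lin :: "('a::field ^ 'n \<Rightarrow> 'a ^ 'm) \<Rightarrow> bool"
  where "lin f \<equiv> Vector_Spaces.linear (*s) (*s) f"

lemma linI:
  assumes "\<And>x y. f (x + y) = f x + f y" "\<And>a x. f (a *s x) = a *s f x"
  shows "lin f"
  using assms by (simp add: Vector_Spaces.linear_iff vec.vector_space_axioms)

lemma
  assumes "lin f"
  shows lin_add: "f (x + y) = f x + f y"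
    and lin_scale: "f (a *s x) = a *s f x"
    and lin_zero: "f 0 = 0"
    and lin_minus: "f (- x) = - f x"
    and lin_diff: "f (x - y) = f x - f y"
    and lin_sum: "f (sum h S) = (\<Sum>i\<in>S. f (h i))"
proof -
  interpret f: Vector_Spaces.linear "(*s)" "(*s)" f by (fact assms)
  show "f (x + y) = f x + f y" "f (a *s x) = a *s f x" "f 0 = 0" "f (- x) = - f x"
    "f (x - y) = f x - f y" "f (sum h S) = (\<Sum>i\<in>S. f (h i))"
    by (simp_all add: f.add f.scale f.zero f.neg f.diff f.sum)
qed

lemmas lin_simps = lin_add lin_scale lin_zero lin_minus lin_diff

lemmas scale_simps = vec.scale_right_distrib vec.scale_left_distrib vec.scale_right_diff_distrib
  vec.scale_left_diff_distrib

locale quadratic_space =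
  fixes Q :: "('a::{field,finite}) ^ ('n::finite) \<Rightarrow> 'a"
  assumes quadratic: "quadratic_form Q"
    and nondegenerate: "nondegenerate Q"
    and two_neq_0: "(2::'a) \<noteq> 0"
begin

abbreviation B :: "'a ^ 'n \<Rightarrow> 'a ^ 'n \<Rightarrow> 'a"
  where "B \<equiv> assoc_form Q"

lemma B_sym: "B x y = B y x"
  by (simp add: assoc_form_def add.commute algebra_simps)

lemma B_add_right: "B x (y + z) = B x y + B x z"
  and B_scale_right: "B x (a *s y) = a * B x y"
  using quadratic by (auto simp: quadratic_form_def Vector_Spaces.linear_iff)

lemma B_add_left: "B (y + z) x = B y x + B z x"
  and B_scale_left: "B (a *s y) x = a * B y x"
  by (simp_all add: B_sym[of _ x] B_add_right B_scale_right)

lemma B_minus_right: "B x (- y) = - B x y"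
  using B_scale_right[of x "-1" y] by simp

lemma B_minus_left: "B (- y) x = - B y x"
  by (simp add: B_sym[of _ x] B_minus_right)

lemma B_diff_right: "B x (y - z) = B x y - B x z"
  using B_add_right[of x y "- z"] by (simp add: B_minus_right)

lemma B_diff_left: "B (y - z) x = B y x - B z x"
  by (simp add: B_sym[of _ x] B_diff_right)

lemma B_zero_right: "B x 0 = 0"
  using B_scale_right[of x 0 0] by simp

lemma B_zero_left: "B 0 x = 0"
  by (simp add: B_sym[of _ x] B_zero_right)

lemmas B_simps = B_add_right B_scale_right B_add_left B_scale_left B_minus_right B_minus_left
  B_diff_right B_diff_left B_zero_right B_zero_left

lemma B_self: "B x x = Q x"
proof -
  have "Q (x + x) = 2\<^sup>2 * Q x"
    using quadratic unfolding quadratic_form_def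
    by (metis one_add_one scaleR_2 vec.scale_left_distrib vec.scale_one)
  then show ?thesis
    using two_neq_0 by (simp add: assoc_form_def field_simps power2_eq_square)
qed

lemma Q_scale: "Q (a *s x) = a\<^sup>2 * Q x"
  using quadratic by (simp add: quadratic_form_def)

lemma Q_add: "Q (x + y) = Q x + 2 * B x y + Q y"
  using two_neq_0 by (simp add: assoc_form_def field_simps)

lemma eq_0_if_orthogonal: "(\<And>y. B x y = 0) \<Longrightarrow> x = 0"
  using nondegenerate by (auto simp: nondegenerate_def)

definition nondegenerate_on :: "('a ^ 'n) set \<Rightarrow> bool" where
  "nondegenerate_on W \<longleftrightarrow> (\<forall>x\<in>W. (\<forall>y\<in>W. B x y = 0) \<longrightarrow> x = 0)"

definition orth_compl :: "('a ^ 'n) set \<Rightarrow> ('a ^ 'n) set" where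
  "orth_compl U = {x. \<forall>y\<in>U. B x y = 0}"

lemma subspace_orth_compl: "vec.subspace (orth_compl U)"
  by (rule vec.subspaceI) (auto simp: orth_compl_def B_simps)

text \<open>
  The form \<open>B (f x) y\<close> is symmetric because \<open>f\<close> is self-adjoint, and in odd characteristic a
  symmetric form is determined by its diagonal.
\<close>

lemma symmetric_form_polarization:
  assumes W: "vec.subspace W" and f: "lin f"
    and adj: "\<And>x y. B (f x) y = B x (f y)"
    and iso: "\<And>x. x \<in> W \<Longrightarrow> B (f x) x = 0"
    and x: "x \<in> W" and y: "y \<in> W"
  shows "B (f x) y = 0"
proof -
  have "B (f (x + y)) (x + y) = 0" using iso vec.subspace_add[OF W x y] by blast
  moreover have "B (f y) x = B (f x) y" by (metis adj B_sym)
  ultimately have "2 * B (f x) y = 0"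
    using iso[OF x] iso[OF y] by (simp add: lin_simps[OF f] B_simps)
  then show ?thesis using two_neq_0 by simp
qed

lemma ex_anisotropic:
  assumes W: "vec.subspace W" and nd: "nondegenerate_on W" and x: "x \<in> W" "x \<noteq> 0"
  shows "\<exists>a\<in>W. Q a \<noteq> 0"
proof (rule ccontr)
  assume "\<not> ?thesis"
  then have "\<And>x. x \<in> W \<Longrightarrow> B (id x) x = 0" by (auto simp: B_self)
  then have "B x y = 0" if "y \<in> W" for y
    using symmetric_form_polarization[OF W vec.linear_id] x that by (auto simp: id_def)
  then show False using nd x by (auto simp: nondegenerate_on_def)
qed

text \<open>
  Gram-Schmidt: a nonzero nondegenerate subspace contains an anisotropic vector \<open>a\<close>, and the vectors
  orthogonal to \<open>a\<close> form a smaller nondegenerate subspace.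
\<close>

lemma orthogonal_projection_exists:
  assumes "vec.subspace U" "nondegenerate_on U"
  shows "\<exists>u\<in>U. w - u \<in> orth_compl U"
  using assms
proof (induction "card U" arbitrary: U w rule: less_induct)
  case less
  note U = less.prems(1) and nd = less.prems(2)
  show ?case
  proof (cases "U = {0}")
    case True
    then show ?thesis by (auto simp: orth_compl_def B_simps)
  next
    case False
    then obtain a where a: "a \<in> U" "Q a \<noteq> 0"
      using ex_anisotropic[OF U nd] vec.subspace_0[OF U] by blast
    define U' where "U' = {x\<in>U. B x a = 0}"
    have U': "vec.subspace U'"
      unfolding U'_def by (rule vec.subspaceI)
        (auto simp: B_simps vec.subspace_0[OF U] vec.subspace_add[OF U] vec.subspace_scale[OF U])
    have "a \<notin> U'" using a by (simp add: U'_def B_self)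
    then have card: "card U' < card U"
      using a(1) by (intro psubset_card_mono) (auto simp: U'_def)
    have dec: "\<exists>y'\<in>U'. \<exists>m. y = y' + m *s a" if y: "y \<in> U" for y
    proof (intro bexI exI)
      show "y = (y - (B y a / Q a) *s a) + (B y a / Q a) *s a" by simp
      show "y - (B y a / Q a) *s a \<in> U'"
        using a y by (auto simp: U'_def B_simps B_self intro!: vec.subspace_diff[OF U] vec.subspace_scale[OF U])
    qed
    have nd': "nondegenerate_on U'"
      unfolding nondegenerate_on_def
    proof (intro ballI impI)
      fix x assume x: "x \<in> U'" "\<forall>y\<in>U'. B x y = 0"
      have "B x y = 0" if "y \<in> U" for y
        using dec[OF that] x by (auto simp: B_simps U'_def)
      then show "x = 0" using nd x by (auto simp: nondegenerate_on_def U'_def)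
    qed
    obtain u where u: "u \<in> U'" "w - u \<in> orth_compl U'"
      using less.hyps[OF card U' nd'] by blast
    define l where "l = B (w - u) a / Q a"
    have "u + l *s a \<in> U"
      using u a by (auto simp: U'_def intro!: vec.subspace_add[OF U] vec.subspace_scale[OF U])
    moreover have "B (w - (u + l *s a)) y = 0" if yU: "y \<in> U" for y
    proof -
      obtain y' m where y': "y' \<in> U'" "y = y' + m *s a" using dec[OF yU] by blast
      have "B (w - u) y' = 0" "B a y' = 0"
        using u y' by (auto simp: orth_compl_def U'_def B_sym[of a])
      moreover have "B (w - u) a = l * Q a" using a by (simp add: l_def)
      ultimately show ?thesis by (simp add: y' B_simps B_self algebra_simps)
    qed
    ultimately show ?thesis by (auto simp: orth_compl_def)
  qed
qed

lemma nondegenerate_on_orth_compl: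
  assumes W: "vec.subspace W" "nondegenerate_on W"
    and U: "vec.subspace U" "nondegenerate_on U" "U \<subseteq> W"
  shows "nondegenerate_on (W \<inter> orth_compl U)"
    and "W = {x + y | x y. x \<in> U \<and> y \<in> W \<inter> orth_compl U}"
proof -
  show dec: "W = {x + y | x y. x \<in> U \<and> y \<in> W \<inter> orth_compl U}"
  proof (intro subset_antisym subsetI)
    fix w assume w: "w \<in> W"
    obtain u where u: "u \<in> U" "w - u \<in> orth_compl U"
      using orthogonal_projection_exists[OF U(1,2)] by blast
    have "w = u + (w - u)" by simp
    moreover have "w - u \<in> W" using W(1) w u U(3) by (auto intro: vec.subspace_diff)
    ultimately show "w \<in> {x + y | x y. x \<in> U \<and> y \<in> W \<inter> orth_compl U}" using u by blast
  qed (use U(3) vec.subspace_add[OF W(1)] in auto)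
  show "nondegenerate_on (W \<inter> orth_compl U)"
    unfolding nondegenerate_on_def
  proof (intro ballI impI)
    fix x assume x: "x \<in> W \<inter> orth_compl U" "\<forall>y\<in>W \<inter> orth_compl U. B x y = 0"
    have "B x w = 0" if w: "w \<in> W" for w
    proof -
      obtain u y where "w = u + y" "u \<in> U" "y \<in> W \<inter> orth_compl U"
        using dec w by blast
      then show ?thesis using x by (auto simp: B_simps orth_compl_def)
    qed
    then show "x = 0" using W(2) x by (auto simp: nondegenerate_on_def)
  qed
qed

end

text \<open>
  The powers of \<open>f\<close> are eventually periodic, and a multiple of the period that is large enough is an
  exponent as required. Applied to a self-adjoint operator this yields a Fitting decomposition: the
  image and the kernel of the idempotent are orthogonal complements on which the operator is
  invertible and nilpotent, respectively.
\<close>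

lemma idempotent_power:
  fixes f :: "'v::finite \<Rightarrow> 'v"
  shows "\<exists>k>0. f ^^ (k + k) = f ^^ k"
proof -
  have "\<not> inj (\<lambda>i. f ^^ i)"
    using finite_imageD[of "\<lambda>i. f ^^ i" "UNIV :: nat set"] by auto
  then obtain i j where ij: "i < j" "f ^^ i = f ^^ j"
    unfolding inj_def by (metis linorder_neqE_nat)
  have step: "f ^^ (m + (j - i)) = f ^^ m" if "i \<le> m" for m
  proof -
    have "m + (j - i) = (m - i) + j" "m = (m - i) + i" using that ij by auto
    then show ?thesis using ij by (metis funpow_add)
  qed
  have steps: "f ^^ (m + t * (j - i)) = f ^^ m" if "i \<le> m" for m t
  proof (induction t)
    case (Suc t)
    have "m + Suc t * (j - i) = (m + t * (j - i)) + (j - i)" by simp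
    also have "f ^^ \<dots> = f ^^ (m + t * (j - i))" by (rule step) (use that in simp)
    finally show ?case using Suc by (rule trans)
  qed simp
  define N where "N = Suc i * (j - i)"
  have "Suc i * 1 \<le> N" unfolding N_def using ij by (intro mult_le_mono2) simp
  then have "i \<le> N" "N > 0" by simp_all
  then show ?thesis using steps[of N "Suc i"] unfolding N_def[symmetric] by blast
qed

section \<open>Commuting self-adjoint and skew-adjoint operators\<close>

text \<open>
  The properties of \<open>c = g + g\<^sup>-\<^sup>1\<close> and \<open>d = g - g\<^sup>-\<^sup>1\<close> for an isometry \<open>g\<close>; the last one is the
  identity \<open>d\<^sup>2 = c\<^sup>2 - 4\<close>.
\<close>

locale skew_pair = quadratic_space Q for Q :: "('a::{field,finite}) ^ ('n::finite) \<Rightarrow> 'a" +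
  fixes c d :: "'a ^ 'n \<Rightarrow> 'a ^ 'n"
  assumes lin_c: "lin c" and lin_d: "lin d"
    and c_adj: "B (c x) y = B x (c y)"
    and d_adj: "B (d x) y = - B x (d y)"
    and cd: "c (d x) = d (c x)"
    and dd: "d (d x) = c (c x) - 4 *s x"
begin

text \<open>
  The space as a module over the polynomial ring, the indeterminate acting as \<open>c\<close>.
\<close>

definition act :: "'a poly \<Rightarrow> 'a ^ 'n \<Rightarrow> 'a ^ 'n" where
  "act p = fold_coeffs (\<lambda>a f x. a *s x + c (f x)) p (\<lambda>x. 0)"

lemma act_0 [simp]: "act 0 x = 0"
  by (simp add: act_def)

lemma act_pCons [simp]: "act (pCons a p) x = a *s x + c (act p x)"
  by (cases "p = 0 \<and> a = 0") (auto simp: act_def lin_zero[OF lin_c])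

lemma act_1 [simp]: "act 1 x = x"
  by (simp add: one_pCons lin_zero[OF lin_c])

lemma lin_act: "lin (act p)"
proof (rule linI)
  show "act p (x + y) = act p x + act p y" for x y
    by (induction p) (simp_all add: lin_simps[OF lin_c] scale_simps)
  show "act p (a *s x) = a *s act p x" for a x
    by (induction p) (simp_all add: lin_simps[OF lin_c] scale_simps mult.commute)
qed

lemmas act_simps = lin_simps[OF lin_act]

lemma act_add: "act (p + q) x = act p x + act q x"
  by (induction p q rule: poly_induct2) (simp_all add: lin_simps[OF lin_c] scale_simps)

lemma act_smult: "act (smult a p) x = a *s act p x"
  by (induction p) (simp_all add: lin_simps[OF lin_c] scale_simps)

lemma act_minus: "act (- p) x = - act p x"
  using act_smult[of "-1" p x] by simp

lemma act_diff: "act (p - q) x = act p x - act q x"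
  using act_add[of p "- q" x] by (simp add: act_minus)

lemma act_mult: "act (p * q) x = act p (act q x)"
  by (induction p) (simp_all add: act_add act_smult lin_simps[OF lin_c] mult_pCons_left)

lemma act_commute: "act p (act q x) = act q (act p x)"
  by (metis act_mult mult.commute)

lemma act_c: "act p (c x) = c (act p x)"
  by (induction p) (simp_all add: lin_simps[OF lin_c])

lemma act_d: "act p (d x) = d (act p x)"
  by (induction p) (simp_all add: lin_simps[OF lin_c] lin_simps[OF lin_d] cd)

lemma act_adj: "B (act p x) y = B x (act p y)"
  by (induction p arbitrary: y) (simp_all add: B_simps c_adj act_c)

lemma act_power: "act (p ^ k) = act p ^^ k"
  by (induction k) (auto simp: act_mult fun_eq_iff)

text \<open>
  The operator \<open>p(c) q(c) d\<close> is skew-adjoint, hence alternating in odd characteristic. This is what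
  makes the submodules generated by \<open>x\<close> and by \<open>d x\<close> orthogonal.
\<close>

lemma B_act_d_self: "B (act p x) (act q (d x)) = 0"
proof -
  have "B (act p x) (act q (d x)) = B (act (p * q) x) (d x)"
    by (simp add: act_adj act_mult act_commute)
  also have "\<dots> = - B (d (act (p * q) x)) x"
    by (simp add: d_adj)
  also have "\<dots> = - B (act (p * q) (d x)) x" by (simp add: act_d)
  also have "\<dots> = - B (act (p * q) x) (d x)" by (metis act_adj B_sym)
  finally have *: "B (act p x) (act q (d x)) = - B (act p x) (act q (d x))"
    by (simp add: act_adj act_mult act_commute)
  then have "2 * B (act p x) (act q (d x)) = 0" by simp
  then show ?thesis using two_neq_0 by simp
qed

text \<open>
  The polynomial by which \<open>d\<^sup>2\<close> acts. It is the product of \<open>x - 2\<close> and \<open>x + 2\<close>, so \<open>d\<close> fails to be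
  invertible only where \<open>c\<close> has eigenvalue \<open>2\<close> or \<open>-2\<close>, that is, where \<open>g\<close> has eigenvalue \<open>1\<close> or
  \<open>-1\<close>.
\<close>

definition delta :: "'a poly" where "delta = [:-4, 0, 1:]"

lemma act_delta: "act delta x = d (d x)"
  by (simp add: delta_def dd lin_simps[OF lin_c])

definition invariant :: "('a ^ 'n) set \<Rightarrow> bool" where
  "invariant W \<longleftrightarrow> vec.subspace W \<and> (\<forall>x\<in>W. c x \<in> W) \<and> (\<forall>x\<in>W. d x \<in> W)"

lemma invariant_act: "invariant W \<Longrightarrow> x \<in> W \<Longrightarrow> act p x \<in> W"
  by (induction p) (auto simp: invariant_def intro: vec.subspace_add vec.subspace_scale vec.subspace_0)

text \<open>
  An involution that is \<open>1\<close> on \<open>X\<close> and \<open>-1\<close> on \<open>Y\<close> commutes with \<open>c\<close> and anticommutes with \<open>d\<close>, and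
  therefore inverts \<open>g\<close>, exactly under these conditions.
\<close>

definition graded :: "('a ^ 'n) set \<Rightarrow> ('a ^ 'n) set \<Rightarrow> bool" where
  "graded X Y \<longleftrightarrow> vec.subspace X \<and> vec.subspace Y \<and> (\<forall>x\<in>X. \<forall>y\<in>Y. B x y = 0) \<and>
     (\<forall>x\<in>X. c x \<in> X \<and> d x \<in> Y) \<and> (\<forall>y\<in>Y. c y \<in> Y \<and> d y \<in> X)"

definition gradable :: "('a ^ 'n) set \<Rightarrow> bool" where
  "gradable W \<longleftrightarrow> (\<exists>X Y. graded X Y \<and> W = {x + y | x y. x \<in> X \<and> y \<in> Y})"

lemma gradable_0: "gradable {0}"
  unfolding gradable_def graded_def
  by (rule exI[of _ "{0}"], rule exI[of _ "{0}"])
     (auto simp: B_simps lin_simps[OF lin_c] lin_simps[OF lin_d])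

lemma sums_swap:
  fixes X1 :: "('v::ab_group_add) set"
  shows "{u + v | u v. u \<in> {x + y | x y. x \<in> X1 \<and> y \<in> Y1} \<and> v \<in> {x + y | x y. x \<in> X2 \<and> y \<in> Y2}} =
    {x + y | x y. x \<in> {u + v | u v. u \<in> X1 \<and> v \<in> X2} \<and> y \<in> {u + v | u v. u \<in> Y1 \<and> v \<in> Y2}}"
    (is "?L = ?R")
proof (intro subset_antisym subsetI)
  fix w assume "w \<in> ?L"
  then obtain x1 y1 x2 y2 where "x1 \<in> X1" "y1 \<in> Y1" "x2 \<in> X2" "y2 \<in> Y2"
    "w = (x1 + y1) + (x2 + y2)" by blast
  moreover from this have "w = (x1 + x2) + (y1 + y2)" by (simp add: algebra_simps)
  ultimately show "w \<in> ?R" by blast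
next
  fix w assume "w \<in> ?R"
  then obtain x1 y1 x2 y2 where "x1 \<in> X1" "y1 \<in> Y1" "x2 \<in> X2" "y2 \<in> Y2"
    "w = (x1 + x2) + (y1 + y2)" by blast
  moreover from this have "w = (x1 + y1) + (x2 + y2)" by (simp add: algebra_simps)
  ultimately show "w \<in> ?L" by blast
qed

lemma graded_sum:
  assumes g1: "graded X1 Y1" and g2: "graded X2 Y2"
    and orth: "\<And>u v. u \<in> {x + y | x y. x \<in> X1 \<and> y \<in> Y1} \<Longrightarrow> v \<in> {x + y | x y. x \<in> X2 \<and> y \<in> Y2} \<Longrightarrow> B u v = 0"
  shows "graded {u + v | u v. u \<in> X1 \<and> v \<in> X2} {u + v | u v. u \<in> Y1 \<and> v \<in> Y2}"
proof -
  have z: "0 \<in> X1" "0 \<in> X2" "0 \<in> Y1" "0 \<in> Y2"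
    using g1 g2 by (auto simp: graded_def vec.subspace_0)
  have 1: "B x y = 0" if "x \<in> X1" "y \<in> Y2" for x y
    using orth[of "x + 0" "0 + y"] that z by (metis (mono_tags, lifting) add.right_neutral add_0 mem_Collect_eq)
  have 2: "B x y = 0" if "x \<in> X2" "y \<in> Y1" for x y
    using orth[of "0 + y" "x + 0"] that z B_sym by (metis (mono_tags, lifting) add.right_neutral add_0 mem_Collect_eq)
  show ?thesis
    unfolding graded_def
  proof (intro conjI ballI)
    show "vec.subspace {u + v | u v. u \<in> X1 \<and> v \<in> X2}" "vec.subspace {u + v | u v. u \<in> Y1 \<and> v \<in> Y2}"
      using g1 g2 by (auto simp: graded_def intro: vec.subspace_sums)
  next
    fix x y assume "x \<in> {u + v | u v. u \<in> X1 \<and> v \<in> X2}" "y \<in> {u + v | u v. u \<in> Y1 \<and> v \<in> Y2}"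
    then show "B x y = 0"
      using g1 g2 1 2 by (auto simp: graded_def B_simps)
  qed (use g1 g2 in \<open>auto simp: graded_def lin_simps[OF lin_c] lin_simps[OF lin_d]; blast\<close>)+
qed

lemma gradable_sum:
  assumes "gradable U" "gradable V" "\<And>u v. u \<in> U \<Longrightarrow> v \<in> V \<Longrightarrow> B u v = 0"
  shows "gradable {u + v | u v. u \<in> U \<and> v \<in> V}"
proof -
  obtain X1 Y1 X2 Y2 where g: "graded X1 Y1" "U = {x + y | x y. x \<in> X1 \<and> y \<in> Y1}"
    "graded X2 Y2" "V = {x + y | x y. x \<in> X2 \<and> y \<in> Y2}"
    using assms(1,2) by (auto simp: gradable_def)
  have "graded {u + v | u v. u \<in> X1 \<and> v \<in> X2} {u + v | u v. u \<in> Y1 \<and> v \<in> Y2}"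
    using g assms(3) by (intro graded_sum) auto
  then show ?thesis
    unfolding gradable_def g(2,4) sums_swap by blast
qed

lemma graded_invariant:
  assumes "graded X Y"
  shows "invariant {x + y | x y. x \<in> X \<and> y \<in> Y}"
  unfolding invariant_def
proof (intro conjI ballI)
  show "vec.subspace {x + y | x y. x \<in> X \<and> y \<in> Y}"
    using assms by (auto simp: graded_def intro: vec.subspace_sums)
  fix w assume "w \<in> {x + y | x y. x \<in> X \<and> y \<in> Y}"
  then obtain x y where w: "w = x + y" "x \<in> X" "y \<in> Y" by blast
  have "c w = c x + c y" "d w = d y + d x"
    by (simp_all add: w lin_simps[OF lin_c] lin_simps[OF lin_d])
  then show "c w \<in> {x + y | x y. x \<in> X \<and> y \<in> Y}" "d w \<in> {x + y | x y. x \<in> X \<and> y \<in> Y}"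
    using assms w unfolding graded_def by blast+
qed

end

text \<open>
  A nondegenerate invariant subspace on which the polynomials in \<open>c\<close> form a local ring with maximal
  ideal generated by \<open>\<pi>\<close>, where \<open>l + 1\<close> is the nilpotency index of \<open>\<pi>\<close>. Every nonzero ideal of such a
  ring contains \<open>\<pi>\<^sup>l\<close>, and so the submodule generated by a vector \<open>u\<close> is nondegenerate as soon as
  \<open>B (\<pi>\<^sup>l u) u\<close> is nonzero.
\<close>

locale local_module = skew_pair Q c d for Q :: "('a::{field,finite}) ^ ('n::finite) \<Rightarrow> 'a" and c d +
  fixes W :: "('a ^ 'n) set" and \<pi> :: "'a poly" and l :: nat
  assumes W_inv: "invariant W" and W_nondeg: "nondegenerate_on W"
    and loc: "\<not> \<pi> dvd p \<Longrightarrow> \<exists>r. \<forall>x\<in>W. act (p * r) x = x"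
    and pi_nil: "x \<in> W \<Longrightarrow> act (\<pi> ^ Suc l) x = 0"
    and pi_l: "\<exists>x\<in>W. act (\<pi> ^ l) x \<noteq> 0"
begin

definition unit_on :: "'a poly \<Rightarrow> 'a poly \<Rightarrow> bool" where
  "unit_on p r \<longleftrightarrow> (\<forall>x\<in>W. act (p * r) x = x)"

lemma W_sub: "vec.subspace W" and W_d: "x \<in> W \<Longrightarrow> d x \<in> W" and W_act: "x \<in> W \<Longrightarrow> act p x \<in> W"
  using W_inv invariant_act by (auto simp: invariant_def)

lemma pi_high:
  assumes "x \<in> W" "l < k"
  shows "act (\<pi> ^ k) x = 0"
proof -
  have "\<pi> ^ k = \<pi> ^ (k - Suc l) * \<pi> ^ Suc l"
    by (metis assms(2) Suc_leI le_add_diff_inverse2 power_add)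
  then show ?thesis using pi_nil[OF assms(1)] by (simp only: act_mult act_simps)
qed

text \<open>
  What remains after dividing \<open>p\<close> by \<open>\<pi>\<close> as often as possible is a unit, by locality. The exponent
  \<open>l + 1\<close> stands for a polynomial that vanishes on \<open>W\<close>.
\<close>

lemma valuation:
  "\<exists>j q r. unit_on q r \<and> j \<le> Suc l \<and> (\<forall>x\<in>W. act p x = act (\<pi> ^ j * q) x)"
proof -
  have "\<pi> ^ i dvd p \<or> (\<exists>j<i. \<exists>q r. p = \<pi> ^ j * q \<and> unit_on q r)" for i
  proof (induction i)
    case (Suc i)
    then show ?case
    proof (elim disjE)
      assume "\<pi> ^ i dvd p"
      then obtain q where q: "p = \<pi> ^ i * q" by (elim dvdE)
      show ?thesis
      proof (cases "\<pi> dvd q")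
        case True
        then show ?thesis unfolding q by (auto simp: mult.commute intro: mult_dvd_mono)
      next
        case False
        then show ?thesis using loc[OF False] q by (auto simp: unit_on_def)
      qed
    qed (use less_SucI in blast)
  qed simp
  from this[of "Suc l"] show ?thesis
  proof (elim disjE exE conjE)
    assume "\<pi> ^ Suc l dvd p"
    then obtain q where "p = q * \<pi> ^ Suc l" by (metis dvdE mult.commute)
    then have "\<forall>x\<in>W. act p x = act (\<pi> ^ Suc l * 1) x"
      using pi_nil by (simp add: act_mult act_simps del: power_Suc)
    then show ?thesis by (metis act_1 le_refl mult_1 unit_on_def)
  qed (metis less_imp_le)
qed

lemma unit_act: "unit_on q r \<Longrightarrow> x \<in> W \<Longrightarrow> act q (act r x) = x"
  by (simp add: unit_on_def act_mult)

text \<open>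
  The second factor complements \<open>\<pi>\<^sup>j q\<close> to \<open>\<pi>\<^sup>l\<close>. All nondegeneracy proofs below find their test vector
  in this way.
\<close>

lemma B_pair:
  assumes q: "unit_on q r" and x: "x \<in> W" and j: "j \<le> l"
  shows "B (act (\<pi> ^ j * q) x) (act (r * \<pi> ^ (l - j)) y) = B (act (\<pi> ^ l) x) y"
proof -
  have "B (act (\<pi> ^ j * q) x) (act (r * \<pi> ^ (l - j)) y)
      = B (act (\<pi> ^ j * \<pi> ^ (l - j)) (act q (act r x))) y"
    by (simp add: act_mult flip: act_adj) (simp add: act_commute)
  also have "\<dots> = B (act (\<pi> ^ l) x) y"
    using j by (simp add: unit_act[OF q x] flip: power_add)
  finally show ?thesis .
qed

definition cyc :: "'a ^ 'n \<Rightarrow> ('a ^ 'n) set" where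
  "cyc x = range (\<lambda>p. act p x)"

lemma subspace_cyc: "vec.subspace (cyc x)"
proof (rule vec.subspaceI)
  show "0 \<in> cyc x" unfolding cyc_def by (metis act_0 rangeI)
  show "u + v \<in> cyc x" if "u \<in> cyc x" "v \<in> cyc x" for u v
    using that unfolding cyc_def by (auto simp flip: act_add)
  show "a *s u \<in> cyc x" if "u \<in> cyc x" for u a
    using that unfolding cyc_def by (auto simp flip: act_smult)
qed

lemma c_cyc: "u \<in> cyc x \<Longrightarrow> c u \<in> cyc x"
proof -
  assume "u \<in> cyc x"
  then obtain p where "u = act p x" by (auto simp: cyc_def)
  then have "c u = act (pCons 0 p) x" by simp
  then show ?thesis unfolding cyc_def by blast
qed

lemma d_cyc: "u \<in> cyc x \<Longrightarrow> d u \<in> cyc (d x)"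
  unfolding cyc_def by (auto simp flip: act_d)

lemma dd_cyc: "u \<in> cyc (d x) \<Longrightarrow> d u \<in> cyc x"
  unfolding cyc_def by (auto simp flip: act_d act_delta act_mult)

lemma cyc_W: "x \<in> W \<Longrightarrow> cyc x \<subseteq> W"
  unfolding cyc_def using W_act by auto

lemma cyc_self: "x \<in> cyc x"
  unfolding cyc_def by (metis act_1 rangeI)

lemma nondegenerate_on_sum:
  assumes X: "nondegenerate_on X" "0 \<in> X" and Y: "nondegenerate_on Y" "0 \<in> Y"
    and o: "\<And>x y. x \<in> X \<Longrightarrow> y \<in> Y \<Longrightarrow> B x y = 0"
  shows "nondegenerate_on {x + y | x y. x \<in> X \<and> y \<in> Y}"
  unfolding nondegenerate_on_def
proof safe
  fix x y assume xy: "x \<in> X" "y \<in> Y"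
    and *: "\<forall>v\<in>{x + y | x y. x \<in> X \<and> y \<in> Y}. B (x + y) v = 0"
  have "B x v = 0" if "v \<in> X" for v
  proof -
    have "v + 0 \<in> {x + y | x y. x \<in> X \<and> y \<in> Y}" using that Y(2) by blast
    from bspec[OF * this] show ?thesis using o[OF that xy(2)] by (simp add: B_simps B_sym[of y])
  qed
  moreover have "B y v = 0" if "v \<in> Y" for v
  proof -
    have "0 + v \<in> {x + y | x y. x \<in> X \<and> y \<in> Y}" using that X(2) by blast
    from bspec[OF * this] show ?thesis using o[OF xy(1) that] by (simp add: B_simps)
  qed
  ultimately show "x + y = 0"
    using X(1) Y(1) xy by (auto simp: nondegenerate_on_def)
qed

text \<open>
  Otherwise the symmetric form \<open>B (\<pi>\<^sup>l x) y\<close> would have zero diagonal on \<open>W\<close> and hence vanish.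
\<close>

lemma ex_self_pairing: "\<exists>u\<in>W. B (act (\<pi> ^ l) u) u \<noteq> 0"
proof (rule ccontr)
  assume "\<not> ?thesis"
  then have *: "\<And>x. x \<in> W \<Longrightarrow> B (act (\<pi> ^ l) x) x = 0" by auto
  obtain x where x: "x \<in> W" "act (\<pi> ^ l) x \<noteq> 0" using pi_l by auto
  have "B (act (\<pi> ^ l) x) y = 0" if "y \<in> W" for y
    using symmetric_form_polarization[OF W_sub lin_act act_adj * x(1) that] .
  then show False
    using W_nondeg x W_act by (auto simp: nondegenerate_on_def)
qed

lemma nondegenerate_on_cyc:
  assumes u: "u \<in> W" and nz: "B (act (\<pi> ^ l) u) u \<noteq> 0"
  shows "nondegenerate_on (cyc u)"
  unfolding nondegenerate_on_def
proof (intro ballI impI)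
  fix x assume x: "x \<in> cyc u" "\<forall>y\<in>cyc u. B x y = 0"
  then obtain p where p: "x = act p u" by (auto simp: cyc_def)
  obtain j q r where q: "unit_on q r" "j \<le> Suc l" "act p u = act (\<pi> ^ j * q) u"
    using valuation[of p] u by blast
  have "\<not> j \<le> l"
  proof
    assume "j \<le> l"
    then have "B x (act (r * \<pi> ^ (l - j)) u) \<noteq> 0"
      using nz by (simp add: p q(3) B_pair[OF q(1) u])
    then show False using x by (auto simp: cyc_def)
  qed
  then have "j = Suc l" using q(2) by simp
  then show "x = 0" using u
    by (simp only: p q(3) act_mult act_commute[of "\<pi> ^ Suc l"] pi_nil act_simps)
qed

text \<open>
  On the module generated by \<open>d u\<close> the form is \<open>B (p (d u)) (p' (d u)) = - B (p p' d\<^sup>2 u) u\<close>, and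
  \<open>d\<^sup>2\<close> costs \<open>k\<close> powers of \<open>\<pi>\<close>. This does no harm if \<open>k = 0\<close>; if \<open>k = 1\<close>, the module is itself shorter
  by one power.
\<close>

lemma nondegenerate_on_cyc_d:
  assumes u: "u \<in> W" and nz: "B (act (\<pi> ^ l) u) u \<noteq> 0"
    and delta: "delta = \<pi> ^ k * eta" "unit_on eta theta"
    and k: "k = 0 \<or> k = 1 \<and> act (\<pi> ^ l) (d u) = 0"
  shows "nondegenerate_on (cyc (d u))"
  unfolding nondegenerate_on_def
proof (intro ballI impI)
  fix x assume x: "x \<in> cyc (d u)" "\<forall>y\<in>cyc (d u). B x y = 0"
  then obtain p where p: "x = act p (d u)" by (auto simp: cyc_def)
  obtain j q r where q: "unit_on q r" "j \<le> Suc l" "act p (d u) = act (\<pi> ^ j * q) (d u)"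
    using valuation[of p] W_d[OF u] by blast
  have "\<not> j + k \<le> l"
  proof
    assume jk: "j + k \<le> l"
    let ?y = "act (r * theta * \<pi> ^ (l - (j + k))) (d u)"
    have "unit_on (q * eta) (r * theta)"
      using q(1) delta(2) W_act unfolding unit_on_def
      by (simp add: act_mult act_commute[of eta r])
    note pair = B_pair[OF this u jk, of u]
    have "B x ?y = B (act (\<pi> ^ j * q) (d u)) (d (act (r * theta * \<pi> ^ (l - (j + k))) u))"
      unfolding p q(3) by (simp add: act_d)
    also have "\<dots> = - B (act (\<pi> ^ j * q) (d (d u))) (act (r * theta * \<pi> ^ (l - (j + k))) u)"
      by (simp add: d_adj act_d)
    also have "act (\<pi> ^ j * q) (d (d u)) = act (\<pi> ^ (j + k) * (q * eta)) u"
      by (simp flip: act_delta act_mult) (simp add: delta(1) power_add mult_ac)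
    finally have "B x ?y \<noteq> 0" using pair nz by simp
    then show False using x by (auto simp: cyc_def)
  qed
  then have "j = Suc l \<or> j = l \<and> act (\<pi> ^ l) (d u) = 0" using q(2) k by auto
  then show "x = 0"
    using pi_nil[OF W_d[OF u]]
    by (auto simp only: p q(3) act_mult act_commute[of "\<pi> ^ j" for j] act_simps)
qed

text \<open>
  The summand is the module generated by one vector \<open>u\<close> over the polynomials in \<open>c\<close> and \<open>d\<close>, graded
  by the parity of the degree in \<open>d\<close>. For \<open>g\<close> unipotent the case \<open>k = 1\<close> is that of a single Jordan
  block of odd size.
\<close>

lemma gradable_summand_cyclic:
  assumes delta: "delta = \<pi> ^ k * eta" "unit_on eta theta"
    and k: "k = 0 \<or> k = 1 \<and> (\<forall>u\<in>W. act (\<pi> ^ l) (d u) = 0)"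
  shows "\<exists>U\<subseteq>W. invariant U \<and> nondegenerate_on U \<and> U \<noteq> {0} \<and> gradable U"
proof -
  obtain u where u: "u \<in> W" "B (act (\<pi> ^ l) u) u \<noteq> 0" using ex_self_pairing by blast
  let ?U = "{x + y | x y. x \<in> cyc u \<and> y \<in> cyc (d u)}"
  have orth: "B x y = 0" if "x \<in> cyc u" "y \<in> cyc (d u)" for x y
    using that B_act_d_self by (auto simp: cyc_def)
  have g: "graded (cyc u) (cyc (d u))"
    unfolding graded_def using subspace_cyc orth c_cyc d_cyc dd_cyc by blast
  have z: "0 \<in> cyc x" for x using subspace_cyc vec.subspace_0 by blast
  have "nondegenerate_on ?U"
    using orth k u delta z by (intro nondegenerate_on_sum nondegenerate_on_cyc nondegenerate_on_cyc_d) auto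
  moreover have "?U \<subseteq> W"
    using cyc_W[OF u(1)] cyc_W[OF W_d[OF u(1)]] vec.subspace_add[OF W_sub] by auto
  moreover have "u + 0 \<in> ?U" using cyc_self[of u] z by blast
  moreover have "u \<noteq> 0" using u by (auto simp: B_simps)
  moreover have "gradable ?U" using g by (auto simp: gradable_def)
  ultimately show ?thesis using graded_invariant[OF g] by (intro exI[of _ ?U]) auto
qed

text \<open>
  The Gram matrix of \<open>u\<close> and \<open>d w\<close> over the local ring has units off the diagonal, and its lower right
  entry \<open>B (d w) (d w)\<close> gains a factor \<open>\<pi>\<close> from \<open>d\<^sup>2\<close>; so its determinant is a unit. The two cases of
  the proof test against \<open>d w\<close> or \<open>u\<close>, depending on which of the two components has the smaller
  valuation.
\<close>

lemma nondegenerate_on_cyc_pair: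
  assumes uw: "u \<in> W" "w \<in> W" and nz: "B (act (\<pi> ^ l) u) (d w) \<noteq> 0"
    and delta: "delta = \<pi> * eta"
  shows "nondegenerate_on {x + y | x y. x \<in> cyc u \<and> y \<in> cyc (d w)}" (is "nondegenerate_on ?X")
  unfolding nondegenerate_on_def
proof (intro ballI impI)
  fix x assume x: "x \<in> ?X" "\<forall>y\<in>?X. B x y = 0"
  then obtain p p' where p: "x = act p u + act p' (d w)" by (auto simp: cyc_def)
  obtain i q r where q: "unit_on q r" "i \<le> Suc l" "act p u = act (\<pi> ^ i * q) u"
    using valuation[of p] uw by blast
  obtain j q' r' where q': "unit_on q' r'" "j \<le> Suc l" "act p' (d w) = act (\<pi> ^ j * q') (d w)"
    using valuation[of p'] W_d[OF uw(2)] by blast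
  have z: "0 \<in> cyc v" for v using subspace_cyc vec.subspace_0 by blast
  have u_in: "act s u \<in> ?X" and w_in: "act s (d w) \<in> ?X" for s
    using z[of u] z[of "d w"] unfolding cyc_def
    by (metis (mono_tags, lifting) add.right_neutral add_0 mem_Collect_eq rangeI)+
  have "\<not> (i \<le> l \<and> i \<le> j)"
  proof
    assume ij: "i \<le> l \<and> i \<le> j"
    let ?y = "act (r * \<pi> ^ (l - i)) (d w)"
    have "B (act p' (d w)) ?y = - B (act (\<pi> ^ j * q' * (r * \<pi> ^ (l - i))) (d (d w))) w"
      unfolding q'(3) by (simp add: act_mult act_adj d_adj act_d) (simp add: act_commute act_adj flip: act_d)
    also have "\<pi> ^ j * q' * (r * \<pi> ^ (l - i)) * delta = \<pi> ^ Suc (j + (l - i)) * (q' * r * eta)"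
      by (simp add: delta power_add mult_ac)
    then have "act (\<pi> ^ j * q' * (r * \<pi> ^ (l - i))) (d (d w)) = act (q' * r * eta) (act (\<pi> ^ Suc (j + (l - i))) w)"
      by (metis act_commute act_delta act_mult)
    also have "act (\<pi> ^ Suc (j + (l - i))) w = 0" using ij by (intro pi_high uw) linarith
    also have "act (q' * r * eta) 0 = 0" by (rule act_simps)
    finally have "B x ?y = B (act (\<pi> ^ l) u) (d w)"
      using ij by (simp add: p B_simps q(3) B_pair[OF q(1) uw(1)])
    then show False using nz bspec[OF x(2) w_in] by simp
  qed
  moreover have "\<not> j < i"
  proof
    assume ji: "j < i"
    then have jl: "j \<le> l" using q(2) by simp
    let ?y = "act (r' * \<pi> ^ (l - j)) u"
    have "B (act p u) ?y = B (act (q * r') (act (\<pi> ^ (i + (l - j))) u)) u"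
      by (simp add: q(3) act_mult act_adj power_add) (simp add: act_commute act_adj)
    also have "\<dots> = 0"
      using pi_high[OF uw(1), of "i + (l - j)"] ji jl by (simp add: act_simps B_simps)
    finally have "B x ?y = B (act (\<pi> ^ l) (d w)) u"
      using jl by (simp add: p B_simps q'(3) B_pair[OF q'(1) W_d[OF uw(2)]])
    also have "\<dots> = B (act (\<pi> ^ l) u) (d w)" by (simp add: act_adj B_sym[of u])
    finally show False using nz bspec[OF x(2) u_in] by simp
  qed
  ultimately have "i = Suc l" "j = Suc l" using q(2) q'(2) by auto
  then show "x = 0" using pi_nil[OF uw(1)] pi_nil[OF W_d[OF uw(2)]]
    by (simp only: p q(3) q'(3) act_mult act_commute[of "\<pi> ^ Suc l"] act_simps) simp
qed

text \<open>
  Subtracting a multiple of \<open>\<pi>\<^sup>l\<^sup>-\<^sup>j d w\<close> from \<open>w\<close> changes \<open>B (\<pi>\<^sup>j u) w\<close> arbitrarily, because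
  \<open>B (\<pi>\<^sup>l u) (d w)\<close> is nonzero, and leaves both \<open>B (\<pi>\<^sup>i u) w\<close> for \<open>i > j\<close> and \<open>B (\<pi>\<^sup>l (d u)) w\<close> unchanged.
  Working down from \<open>j = l\<close> makes \<open>w\<close> orthogonal to the whole module generated by \<open>u\<close>. As \<open>\<pi>\<close> has
  degree one, the residue field is the ground field, and one scalar condition for each power of
  \<open>\<pi>\<close> is enough.
\<close>

lemma orthogonal_adjustment:
  assumes u: "u \<in> W" and nz: "\<exists>w\<in>W. B (act (\<pi> ^ l) (d u)) w \<noteq> 0"
    and delta: "delta = \<pi> * eta" and \<pi>: "\<pi> = [:a, 1:]"
    and i: "i \<le> Suc l"
  shows "\<exists>w\<in>W. B (act (\<pi> ^ l) (d u)) w \<noteq> 0 \<and> (\<forall>p. B (act (\<pi> ^ (Suc l - i) * p) u) w = 0)"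
  using i
proof (induction i)
  case 0
  have "act (\<pi> ^ Suc l * p) u = 0" for p
    using pi_nil[OF u] by (metis act_commute act_mult act_simps(3))
  then show ?case using nz by (auto simp: B_simps simp del: power_Suc)
next
  case (Suc i)
  then obtain w where w: "w \<in> W" "B (act (\<pi> ^ l) (d u)) w \<noteq> 0"
    "\<And>p. B (act (\<pi> ^ (Suc l - i) * p) u) w = 0" by auto
  define j where "j = l - i"
  have j: "j \<le> l" "Suc l - i = Suc j" "Suc l - Suc i = j" using Suc.prems by (auto simp: j_def)
  define b where "b = B (act (\<pi> ^ l) u) (d w)"
  have b: "b \<noteq> 0"
    using w(2) by (simp add: b_def act_d d_adj)
  \<comment> \<open>The scalar that makes \<open>B (\<pi>\<^sup>j u) (w - m \<pi>\<^sup>l\<^sup>-\<^sup>j d w)\<close> vanish.\<close>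
  define m where "m = B (act (\<pi> ^ j) u) w / b"
  define w' where "w' = w - m *s act (\<pi> ^ (l - j)) (d w)"
  have w': "w' \<in> W"
    unfolding w'_def by (intro vec.subspace_diff[OF W_sub] vec.subspace_scale[OF W_sub] w W_act W_d)
  have "B (act (\<pi> ^ l) (d u)) (act (\<pi> ^ (l - j)) (d w)) = - B (act (\<pi> ^ l * \<pi> ^ (l - j) * delta) u) w"
    by (simp add: act_mult act_delta act_d act_adj d_adj) (simp add: act_commute act_adj flip: act_d)
  also have "\<pi> ^ l * \<pi> ^ (l - j) * delta = \<pi> ^ (Suc (l + (l - j))) * eta"
    by (simp add: delta power_add mult_ac)
  also have "act \<dots> u = 0"
    using pi_high[OF u, of "Suc (l + (l - j))"] by (metis act_commute act_mult act_simps(3) le_imp_less_Suc le_add1)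
  finally have "B (act (\<pi> ^ l) (d u)) w' = B (act (\<pi> ^ l) (d u)) w"
    by (simp add: w'_def B_simps)
  moreover have "B (act (\<pi> ^ j * p) u) w' = 0" for p
  proof -
    obtain e s where p: "p = [:e:] + \<pi> * s"
    proof
      have "degree (p mod \<pi>) = 0" using degree_mod_less[of \<pi> p] by (auto simp: \<pi>)
      then have "p mod \<pi> = [:coeff (p mod \<pi>) 0:]" by (rule degree0_coeffs[elim_format]) auto
      then show "p = [:coeff (p mod \<pi>) 0:] + \<pi> * (p div \<pi>)" by (metis add.commute mult_div_mod_eq)
    qed
    have 1: "act (\<pi> ^ j * p) u = e *s act (\<pi> ^ j) u + act (\<pi> ^ Suc j * s) u"
      by (simp add: p act_mult act_add act_smult lin_zero[OF lin_c] act_simps algebra_simps)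
    have 2: "B (act (\<pi> ^ Suc j * s) u) (act (\<pi> ^ (l - j)) (d w)) = 0"
    proof -
      have "B (act (\<pi> ^ Suc j * s) u) (act (\<pi> ^ (l - j)) (d w)) = B (act s (act (\<pi> ^ (Suc j + (l - j))) u)) (d w)"
        by (simp add: act_mult act_adj power_add) (simp add: act_commute act_adj)
      then show ?thesis using pi_high[OF u, of "Suc j + (l - j)"] j by (simp add: act_simps B_simps)
    qed
    have 3: "B (act (\<pi> ^ j) u) (act (\<pi> ^ (l - j)) (d w)) = b"
      using j by (simp add: b_def flip: act_adj act_mult power_add)
    show ?thesis
      using b w(3)[of s] unfolding j(2) 1
      by (simp add: w'_def B_simps 2 3 m_def del: power_Suc)
  qed
  ultimately show ?case using w' w(2) unfolding j(3) by (intro bexI[of _ w']) auto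
qed

text \<open>
  The form \<open>B (\<pi>\<^sup>l (d x)) y\<close> is alternating, so a single generator cannot give a nondegenerate
  summand and two vectors \<open>u\<close>, \<open>w\<close> are used; for \<open>g\<close> unipotent these are two Jordan blocks of equal
  even size. In the grading \<open>u\<close> and \<open>d w\<close> are even while \<open>w\<close> and \<open>d u\<close> are odd, since \<open>u\<close> has to be
  orthogonal to \<open>w\<close> but not to \<open>d w\<close>.
\<close>

lemma gradable_summand_paired:
  assumes delta: "delta = \<pi> * eta" and \<pi>: "\<pi> = [:a, 1:]" and u: "u \<in> W" "act (\<pi> ^ l) (d u) \<noteq> 0"
  shows "\<exists>U\<subseteq>W. invariant U \<and> nondegenerate_on U \<and> U \<noteq> {0} \<and> gradable U"
proof -
  have "\<exists>w\<in>W. B (act (\<pi> ^ l) (d u)) w \<noteq> 0"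
    using W_nondeg u W_act W_d by (auto simp: nondegenerate_on_def)
  from orthogonal_adjustment[OF u(1) this delta \<pi>, of "Suc l"]
  obtain w where w: "w \<in> W" "B (act (\<pi> ^ l) (d u)) w \<noteq> 0" "\<And>p. B (act p u) w = 0" by auto
  have z: "0 \<in> cyc x" for x using subspace_cyc vec.subspace_0 by blast
  let ?X = "{x + y | x y. x \<in> cyc u \<and> y \<in> cyc (d w)}"
  let ?Y = "{x + y | x y. x \<in> cyc w \<and> y \<in> cyc (d u)}"
  let ?U = "{x + y | x y. x \<in> ?X \<and> y \<in> ?Y}"
  have uw: "B (act p u) (act p' w) = 0" for p p'
    using w(3)[of "p' * p"] by (simp add: act_mult act_adj)
  have dwdu: "B (act p (d w)) (act p' (d u)) = 0" for p p'
  proof -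
    have "B (act p (d w)) (act p' (d u)) = - B (act p w) (act (p' * delta) u)"
      by (simp add: act_mult act_delta act_d d_adj)
    then show ?thesis by (metis uw B_sym minus_zero)
  qed
  have orth: "B x y = 0" if "x \<in> ?X" "y \<in> ?Y" for x y
    using that uw dwdu B_act_d_self by (auto simp: cyc_def B_simps B_sym[of "act _ (d w)" "act _ w"])
  have g: "graded ?X ?Y"
    unfolding graded_def
  proof (intro conjI ballI)
    show "vec.subspace ?X" "vec.subspace ?Y" using subspace_cyc by (auto intro: vec.subspace_sums)
  next
    fix x assume "x \<in> ?X"
    then obtain x1 x2 where x: "x = x1 + x2" "x1 \<in> cyc u" "x2 \<in> cyc (d w)" by auto
    then have "c x = c x1 + c x2" "d x = d x2 + d x1"
      by (simp_all add: lin_simps[OF lin_c] lin_simps[OF lin_d])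
    then show "c x \<in> ?X" "d x \<in> ?Y" using x c_cyc d_cyc dd_cyc by blast+
  next
    fix x assume "x \<in> ?Y"
    then obtain x1 x2 where x: "x = x1 + x2" "x1 \<in> cyc w" "x2 \<in> cyc (d u)" by auto
    then have "c x = c x1 + c x2" "d x = d x2 + d x1"
      by (simp_all add: lin_simps[OF lin_c] lin_simps[OF lin_d])
    then show "c x \<in> ?Y" "d x \<in> ?X" using x c_cyc d_cyc dd_cyc by blast+
  qed (use orth in blast)
  have ndX: "nondegenerate_on ?X"
    using w(2) by (intro nondegenerate_on_cyc_pair[OF u(1) w(1) _ delta]) (simp add: act_d d_adj)
  have ndY: "nondegenerate_on ?Y"
    using w(2) by (intro nondegenerate_on_cyc_pair[OF w(1) u(1) _ delta]) (simp add: act_adj B_sym[of w])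
  have zX: "0 \<in> ?X" and zY: "0 \<in> ?Y" using z by force+
  have "nondegenerate_on ?U" by (rule nondegenerate_on_sum[OF ndX zX ndY zY orth])
  have sumW: "{x + y | x y. x \<in> S \<and> y \<in> T} \<subseteq> W" if "S \<subseteq> W" "T \<subseteq> W" for S T
    using that by (auto intro!: vec.subspace_add[OF W_sub])
  have "?U \<subseteq> W" by (intro sumW cyc_W u w W_d)
  have "u \<in> ?X" using cyc_self[of u] z[of "d w"] by (metis (mono_tags, lifting) add.right_neutral mem_Collect_eq)
  then have "u \<in> ?U" using zY by (metis (mono_tags, lifting) add.right_neutral mem_Collect_eq)
  moreover have "u \<noteq> 0" using u by (auto simp: act_simps lin_simps[OF lin_d])
  ultimately have "?U \<noteq> {0}" by blast
  moreover have "gradable ?U" unfolding gradable_def by (intro exI[of _ ?X] exI[of _ ?Y] conjI g refl)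
  ultimately show ?thesis
    using graded_invariant[OF g] \<open>nondegenerate_on ?U\<close> \<open>?U \<subseteq> W\<close> by (intro exI[of _ ?U] conjI)
qed

end

context skew_pair
begin

definition nilpotent_on :: "('a ^ 'n) set \<Rightarrow> 'a poly \<Rightarrow> bool" where
  "nilpotent_on W p \<longleftrightarrow> (\<exists>k. \<forall>x\<in>W. act (p ^ k) x = 0)"

definition invertible_on :: "('a ^ 'n) set \<Rightarrow> 'a poly \<Rightarrow> bool" where
  "invertible_on W p \<longleftrightarrow> (\<exists>r. \<forall>x\<in>W. act (p * r) x = x)"

text \<open>
  Two distinct powers of \<open>c\<close> agree because there are only finitely many operators.
\<close>

lemma exists_nilpotent_poly: "\<exists>p. p \<noteq> 0 \<and> nilpotent_on W p"
proof -
  have "\<not> inj (\<lambda>i. act (monom 1 i))"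
    using finite_imageD[of "\<lambda>i. act (monom 1 i)" "UNIV :: nat set"] by auto
  then obtain i j where ij: "i \<noteq> j" "act (monom 1 i) = act (monom 1 j)"
    unfolding inj_def by blast
  have "act ((monom 1 i - monom 1 j) ^ 1) x = 0" for x
    using ij by (simp add: act_diff)
  moreover have "monom (1::'a) i - monom 1 j \<noteq> 0"
    using ij(1) by (simp add: monom_eq_iff')
  ultimately show ?thesis unfolding nilpotent_on_def by blast
qed

text \<open>
  The remainder \<open>r\<close> of \<open>p\<close> modulo \<open>\<pi>\<close> acts like \<open>p\<close> on a nonzero vector killed by \<open>\<pi>\<close>, so it cannot be
  invertible; hence it is nilpotent, and by minimality of the degree it is zero.
\<close>

lemma minimal_nilpotent_dvd:
  assumes W: "invariant W" "W \<noteq> {0}"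
    and dich: "\<And>p. nilpotent_on W p \<or> invertible_on W p"
    and \<pi>: "\<pi> \<noteq> 0" "nilpotent_on W \<pi>" "\<And>p. p \<noteq> 0 \<Longrightarrow> nilpotent_on W p \<Longrightarrow> degree \<pi> \<le> degree p"
    and p: "nilpotent_on W p"
  shows "\<pi> dvd p"
proof -
  have "0 \<in> W" using W(1) by (auto simp: invariant_def vec.subspace_0)
  then obtain x0 where x0: "x0 \<in> W" "x0 \<noteq> 0" using W(2) by blast
  define k where "k = (LEAST k. act (\<pi> ^ k) x0 = 0)"
  have "\<exists>k. act (\<pi> ^ k) x0 = 0" using \<pi>(2) x0(1) by (auto simp: nilpotent_on_def)
  from LeastI_ex[OF this] have k: "act (\<pi> ^ k) x0 = 0" unfolding k_def .
  then obtain k' where k': "k = Suc k'" using x0 by (cases k) auto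
  \<comment> \<open>The last nonzero vector among the images of \<open>x0\<close> under the powers of \<open>\<pi>\<close>.\<close>
  define x where "x = act (\<pi> ^ k') x0"
  have x: "x \<in> W" "act \<pi> x = 0" using k x0 invariant_act[OF W(1)] by (auto simp: x_def k' act_mult)
  have "x \<noteq> 0" unfolding x_def using not_less_Least[of k' "\<lambda>k. act (\<pi> ^ k) x0 = 0"] k' k_def by auto
  define r where "r = p mod \<pi>"
  have "p = (p div \<pi>) * \<pi> + r" by (simp add: r_def)
  then have "act p x = act ((p div \<pi>) * \<pi> + r) x" by simp
  also have "\<dots> = act r x" by (simp only: act_add act_mult x act_simps add_0)
  finally have "act p x = act r x" .
  then have pr: "act (p ^ m) x = act (r ^ m) x" for m
    by (induction m) (simp_all add: act_mult act_commute[of p] act_commute[of r])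
  have "\<not> invertible_on W r"
  proof
    assume "invertible_on W r"
    then obtain s where s: "\<forall>x\<in>W. act (r * s) x = x" by (auto simp: invertible_on_def)
    have rs: "act (r ^ m * s ^ m) x = x" for m
    proof (induction m)
      case (Suc m)
      have "act (r ^ Suc m * s ^ Suc m) x = act (r * s) (act (r ^ m * s ^ m) x)"
        by (simp flip: act_mult add: mult_ac)
      then show ?case using Suc s x by simp
    qed simp
    obtain m where "act (p ^ m) x = 0" using p x by (auto simp: nilpotent_on_def)
    then have "act (r ^ m * s ^ m) x = 0" using pr by (metis act_commute act_mult act_simps(3))
    then show False using rs \<open>x \<noteq> 0\<close> by metis
  qed
  then have "nilpotent_on W r" using dich by blast
  then have "r = 0" using \<pi>(3)[of r] degree_mod_less[OF \<pi>(1), of p] by (fastforce simp: r_def)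
  then show ?thesis by (simp add: r_def mod_eq_0_iff_dvd)
qed

text \<open>
  If \<open>d\<^sup>2\<close> is invertible, any generator \<open>\<pi>\<close> of the maximal ideal serves. Otherwise \<open>x + 2\<close> or \<open>x - 2\<close>
  is nilpotent, and it generates the maximal ideal because its degree is one; the other factor of
  \<open>d\<^sup>2\<close> is a unit, as \<open>4\<close> is not zero.
\<close>

lemma gradable_summand_local:
  assumes W: "invariant W" "nondegenerate_on W" "W \<noteq> {0}"
    and dich: "\<And>p. nilpotent_on W p \<or> invertible_on W p"
  shows "\<exists>U\<subseteq>W. invariant U \<and> nondegenerate_on U \<and> U \<noteq> {0} \<and> gradable U"
proof -
  have "0 \<in> W" using W(1) by (auto simp: invariant_def vec.subspace_0)
  then obtain x0 where x0: "x0 \<in> W" "x0 \<noteq> 0" using W(3) by blast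
  have excl: "\<not> nilpotent_on W p" if p: "invertible_on W p" for p
  proof
    assume "nilpotent_on W p"
    then obtain k where k: "\<And>x. x \<in> W \<Longrightarrow> act (p ^ k) x = 0" by (auto simp: nilpotent_on_def)
    obtain r where r: "\<And>x. x \<in> W \<Longrightarrow> act (p * r) x = x" using p by (auto simp: invertible_on_def)
    have "act ((p * r) ^ k) x0 = x0"
      by (induction k) (auto simp: act_mult[of "p * r"] r[OF x0(1)])
    moreover have "act ((p * r) ^ k) x0 = act (r ^ k) (act (p ^ k) x0)"
      by (simp add: power_mult_distrib act_mult act_commute)
    ultimately show False using k[OF x0(1)] x0 by (simp add: act_simps)
  qed
  have const: "invertible_on W [:b:]" if "b \<noteq> 0" for b
    unfolding invertible_on_def using that
    by (intro exI[of _ "[:1/b:]"]) (simp add: lin_zero[OF lin_c])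
  have deg_pos: "0 < degree p" if "p \<noteq> 0" "nilpotent_on W p" for p
  proof (rule ccontr)
    assume "\<not> ?thesis"
    then obtain b where "p = [:b:]" using degree0_coeffs by auto
    then show False using const[of b] that excl by (auto simp: one_pCons)
  qed
  have loc: "local_module Q c d W \<pi> l"
    if \<pi>: "\<pi> \<noteq> 0" "nilpotent_on W \<pi>" "\<And>p. p \<noteq> 0 \<Longrightarrow> nilpotent_on W p \<Longrightarrow> degree \<pi> \<le> degree p"
      and l: "\<forall>x\<in>W. act (\<pi> ^ Suc l) x = 0" "\<exists>x\<in>W. act (\<pi> ^ l) x \<noteq> 0" for \<pi> l
  proof (unfold_locales)
    fix p assume "\<not> \<pi> dvd p"
    then show "\<exists>r. \<forall>x\<in>W. act (p * r) x = x"
      using minimal_nilpotent_dvd[OF W(1,3) dich \<pi>] dich by (auto simp: invertible_on_def)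
  qed (use W l in auto)
  have ex_l: "\<exists>l. (\<forall>x\<in>W. act (\<pi> ^ Suc l) x = 0) \<and> (\<exists>x\<in>W. act (\<pi> ^ l) x \<noteq> 0)" if "nilpotent_on W \<pi>" for \<pi>
  proof -
    define k where "k = (LEAST k. \<forall>x\<in>W. act (\<pi> ^ k) x = 0)"
    have "\<exists>k. \<forall>x\<in>W. act (\<pi> ^ k) x = 0" using that by (auto simp: nilpotent_on_def)
    from LeastI_ex[OF this] have k: "\<forall>x\<in>W. act (\<pi> ^ k) x = 0" unfolding k_def .
    then obtain k' where k': "k = Suc k'" using x0 by (cases k) auto
    have "\<not> (\<forall>x\<in>W. act (\<pi> ^ k') x = 0)"
      using not_less_Least[of k' "\<lambda>k. \<forall>x\<in>W. act (\<pi> ^ k) x = 0"] k' k_def by auto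
    then show ?thesis using k k' by blast
  qed
  show ?thesis
  proof (cases "invertible_on W delta")
    case True
    then obtain theta where theta: "\<forall>x\<in>W. act (delta * theta) x = x" by (auto simp: invertible_on_def)
    define N where "N = {p. p \<noteq> 0 \<and> nilpotent_on W p}"
    obtain \<pi> where \<pi>: "\<pi> \<in> N" "\<And>p. p \<in> N \<Longrightarrow> degree \<pi> \<le> degree p"
      using exists_nilpotent_poly[of W] ex_has_least_nat[of "\<lambda>p. p \<in> N" _ degree] unfolding N_def by auto
    obtain l where l: "\<forall>x\<in>W. act (\<pi> ^ Suc l) x = 0" "\<exists>x\<in>W. act (\<pi> ^ l) x \<noteq> 0"
      using ex_l[of \<pi>] \<pi>(1) unfolding N_def by blast
    interpret L: local_module Q c d W \<pi> l
      using \<pi> l by (intro loc) (auto simp: N_def)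
    show ?thesis
      using theta by (intro L.gradable_summand_cyclic[of 0 delta theta]) (auto simp: L.unit_on_def)
  next
    case False
    define p1 p2 where "p1 = [:2, 1::'a:]" and "p2 = [:-2, 1::'a:]"
    have "(2::'a) * 2 \<noteq> 0" using two_neq_0 by (simp del: mult_numeral_1 mult_2 mult_2_right numeral_times_numeral)
    then have four: "(4::'a) \<noteq> 0" by simp
    have fac: "delta = p1 * p2" by (simp add: delta_def p1_def p2_def)
    have "\<not> (invertible_on W p1 \<and> invertible_on W p2)"
    proof
      assume "invertible_on W p1 \<and> invertible_on W p2"
      then obtain r1 r2 where r: "\<forall>x\<in>W. act (p1 * r1) x = x" "\<forall>x\<in>W. act (p2 * r2) x = x"
        by (auto simp: invertible_on_def)
      have "act (delta * (r1 * r2)) x = act (p1 * r1) (act (p2 * r2) x)" for x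
        by (simp flip: act_mult add: fac mult_ac)
      then have "\<forall>x\<in>W. act (delta * (r1 * r2)) x = x" using r by simp
      then have "invertible_on W delta" unfolding invertible_on_def by blast
      with False show False ..
    qed
    then obtain \<pi> eta a where \<pi>: "nilpotent_on W \<pi>" "delta = \<pi> * eta" "\<pi> = [:a,1:]"
      "\<not> \<pi> dvd eta"
    proof (elim de_Morgan_conj[THEN iffD1, elim_format] disjE)
      assume n: "\<not> invertible_on W p1"
      have "\<not> p1 dvd p2" using four by (auto simp: p1_def p2_def dvd_iff_poly_eq_0)
      then show thesis using that[of p1 p2 2] n dich fac by (auto simp: p1_def)
    next
      assume n: "\<not> invertible_on W p2"
      have "\<not> p2 dvd p1" using four by (auto simp: p1_def p2_def dvd_iff_poly_eq_0)
      then show thesis using that[of p2 p1 "-2"] n dich fac by (auto simp: p2_def mult.commute)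
    qed
    obtain l where l: "\<forall>x\<in>W. act (\<pi> ^ Suc l) x = 0" "\<exists>x\<in>W. act (\<pi> ^ l) x \<noteq> 0"
      using ex_l[OF \<pi>(1)] by blast
    interpret L: local_module Q c d W \<pi> l
      using \<pi> l deg_pos by (intro loc) (auto simp: Suc_le_eq)
    obtain theta where theta: "L.unit_on eta theta" using L.loc[OF \<pi>(4)] by (auto simp: L.unit_on_def)
    show ?thesis
    proof (cases "\<forall>u\<in>W. act (\<pi> ^ l) (d u) = 0")
      case True
      then show ?thesis using \<pi> theta by (intro L.gradable_summand_cyclic[of 1 eta theta]) auto
    next
      case False
      then show ?thesis using L.gradable_summand_paired[OF \<pi>(2,3)] by blast
    qed
  qed
qed

text \<open>
  Induction on the size of \<open>W\<close>. If some polynomial in \<open>c\<close> is neither nilpotent nor invertible on \<open>W\<close>,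
  its idempotent power is a nontrivial self-adjoint projection, and its image splits off; otherwise
  \<open>W\<close> is local.
\<close>

lemma nondegenerate_imp_gradable:
  assumes "invariant W" "nondegenerate_on W"
  shows "gradable W"
  using assms
proof (induction "card W" arbitrary: W rule: less_induct)
  case less
  note W = less.prems
  have sub: "vec.subspace W" using W by (simp add: invariant_def)
  have inv_diff: "invariant (W \<inter> orth_compl U)" if U: "invariant U" for U
    unfolding invariant_def
  proof (intro conjI ballI)
    show "vec.subspace (W \<inter> orth_compl U)" by (intro vec.subspace_inter sub subspace_orth_compl)
    fix x assume "x \<in> W \<inter> orth_compl U"
    then show "c x \<in> W \<inter> orth_compl U" "d x \<in> W \<inter> orth_compl U"
      using W(1) U by (auto simp: invariant_def orth_compl_def c_adj d_adj)
  qed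
  have split: "gradable W" if U: "U \<subseteq> W" "invariant U" "nondegenerate_on U" "U \<noteq> {0}" "gradable U" for U
  proof -
    have Us: "vec.subspace U" using U by (simp add: invariant_def)
    note dec = nondegenerate_on_orth_compl[OF sub W(2) Us U(3,1)]
    have "U \<inter> orth_compl U = {0}"
      using U(3) vec.subspace_0[OF Us] vec.subspace_0[OF subspace_orth_compl, of U]
      by (auto simp: nondegenerate_on_def orth_compl_def)
    then have "W \<inter> orth_compl U \<subset> W" using U vec.subspace_0[OF Us] by blast
    then have "card (W \<inter> orth_compl U) < card W" by (intro psubset_card_mono) auto
    then have grad: "gradable (W \<inter> orth_compl U)"
      using less.hyps inv_diff[OF U(2)] dec(1) by blast
    have "B u v = 0" if "u \<in> U" "v \<in> W \<inter> orth_compl U" for u v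
      using that by (auto simp: orth_compl_def B_sym[of u])
    from gradable_sum[OF U(5) grad this] show ?thesis
      unfolding dec(2)[symmetric] .
  qed
  show ?case
  proof (cases "W = {0}")
    case True then show ?thesis by (simp add: gradable_0)
  next
    case nz: False
    show ?thesis
    proof (cases "\<forall>p. nilpotent_on W p \<or> invertible_on W p")
      case True
      then show ?thesis using gradable_summand_local[OF W nz] split by blast
    next
      case False
      then obtain p where p: "\<not> nilpotent_on W p" "\<not> invertible_on W p" by blast
      obtain k where k: "k > 0" "act p ^^ (k + k) = act p ^^ k" using idempotent_power by blast
      define E where "E = act (p ^ k)"
      have EE: "E (E x) = E x" for x
        using k(2) by (metis E_def act_power comp_apply funpow_add)
      have E_adj: "B (E x) y = B x (E y)" for x y by (simp add: E_def act_adj)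
      have linE: "lin E" by (simp add: E_def lin_act)
      define U where "U = E ` W"
      have UW: "U \<subseteq> W" using invariant_act[OF W(1)] by (auto simp: U_def E_def)
      have Uinv: "invariant U"
        unfolding invariant_def
      proof (intro conjI ballI)
        show "vec.subspace U"
          unfolding U_def by (rule vec.linear_subspace_image[OF linE sub])
        fix x assume "x \<in> U"
        then obtain y where "x = E y" "y \<in> W" by (auto simp: U_def)
        moreover from this have "c x = E (c y)" "d x = E (d y)" by (simp_all add: E_def act_c act_d)
        ultimately show "c x \<in> U" "d x \<in> U" using W(1) by (auto simp: U_def invariant_def)
      qed
      have Und: "nondegenerate_on U"
        unfolding nondegenerate_on_def
      proof (intro ballI impI)
        fix x assume x: "x \<in> U" "\<forall>y\<in>U. B x y = 0"
        then have Ex: "E x = x" by (auto simp: U_def EE)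
        have "B x y = 0" if "y \<in> W" for y
          using x that Ex by (metis E_adj U_def imageI)
        then show "x = 0" using x UW W(2) by (auto simp: nondegenerate_on_def)
      qed
      have "\<exists>x\<in>W. E x \<noteq> 0" using p(1) by (auto simp: nilpotent_on_def E_def)
      then have "U \<noteq> {0}" by (auto simp: U_def)
      have "U \<noteq> W"
      proof
        assume "U = W"
        then have "\<forall>x\<in>W. E x = x" using EE by (metis U_def imageE)
        moreover have "E = act (p * p ^ (k - 1))" using k(1) by (simp add: E_def power_eq_if)
        ultimately show False using p(2) by (auto simp: invertible_on_def)
      qed
      then have "card U < card W" using UW by (intro psubset_card_mono) auto
      then have "gradable U" using less.hyps Uinv Und by blast
      then show ?thesis using split UW Uinv Und \<open>U \<noteq> {0}\<close> by blast
    qed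
  qed
qed

end

section \<open>Involutions inverting an isometry\<close>

context quadratic_space
begin

abbreviation inv_map :: "('a ^ 'n \<Rightarrow> 'a ^ 'n) \<Rightarrow> 'a ^ 'n \<Rightarrow> 'a ^ 'n"
  where "inv_map f \<equiv> inv_into UNIV f"

definition isometry :: "('a ^ 'n \<Rightarrow> 'a ^ 'n) \<Rightarrow> bool" where
  "isometry f \<longleftrightarrow> lin f \<and> bij f \<and> (\<forall>v. Q (f v) = Q v)"

lemma isometry_lin: "isometry f \<Longrightarrow> lin f"
  by (simp add: isometry_def)

lemma isometry_B: "isometry f \<Longrightarrow> B (f x) (f y) = B x y"
  by (simp add: isometry_def assoc_form_def flip: lin_add)

lemma isometryI:
  assumes f: "lin f" and B: "\<And>x y. B (f x) (f y) = B x y"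
  shows "isometry f"
proof -
  have "inj f"
  proof (rule injI)
    fix x y assume "f x = f y"
    then have "B (x - y) z = 0" for z
      using B[of "x - y" z] by (simp add: lin_simps[OF f] B_simps)
    then show "x = y" using eq_0_if_orthogonal[of "x - y"] by simp
  qed
  then have "bij f" by (simp add: bij_def finite_UNIV_inj_surj)
  then show ?thesis using f B by (simp add: isometry_def flip: B_self)
qed

lemma isometry_comp: "isometry f \<Longrightarrow> isometry g \<Longrightarrow> isometry (f \<circ> g)"
  by (auto simp: isometry_def bij_comp intro: Vector_Spaces.linear_compose)

lemma isometry_id: "isometry id"
  by (auto simp: isometry_def vec.linear_id)

lemma isometry_inv_simps:
  assumes "isometry f"
  shows "f (inv_map f x) = x" "inv_map f (f x) = x"
  using assms by (auto simp: isometry_def bij_is_inj bij_is_surj surj_f_inv_f)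

lemma isometry_inv:
  assumes f: "isometry f"
  shows "isometry (inv_map f)"
proof (rule isometryI)
  note l = isometry_lin[OF f] and i = isometry_inv_simps[OF f]
  show "lin (inv_map f)"
  proof (rule linI)
    show "inv_map f (x + y) = inv_map f x + inv_map f y" for x y
      using i(2)[of "inv_map f x + inv_map f y"] by (simp add: lin_add[OF l] i(1))
    show "inv_map f (a *s x) = a *s inv_map f x" for a x
      using i(2)[of "a *s inv_map f x"] by (simp add: lin_scale[OF l] i(1))
  qed
  show "B (inv_map f x) (inv_map f y) = B x y" for x y
    using isometry_B[OF f, of "inv_map f x" "inv_map f y"] by (simp add: i(1))
qed

lemma isometry_adj: "isometry f \<Longrightarrow> B (f x) y = B x (inv_map f y)"
  by (metis isometry_inv_simps(1) isometry_B)

lemma isometry_uminus: "isometry f \<Longrightarrow> isometry (\<lambda>x. - f x)"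
  by (rule isometryI; (rule linI)?) (simp_all add: lin_simps isometry_lin B_simps isometry_B)

text \<open>
  The orthogonal sum is direct because the whole space is nondegenerate, so changing the sign on one
  summand is well defined.
\<close>

lemma orthogonal_sign_change:
  assumes X: "vec.subspace X" and Y: "vec.subspace Y"
    and orth: "\<And>x y. x \<in> X \<Longrightarrow> y \<in> Y \<Longrightarrow> B x y = 0"
    and dec: "\<And>v. \<exists>x\<in>X. \<exists>y\<in>Y. v = x + y"
  shows "\<exists>s. isometry s \<and> (\<forall>x\<in>X. \<forall>y\<in>Y. s (x + y) = x - y)"
proof -
  have X0: "x = 0" if x: "x \<in> X" "x \<in> Y" for x
  proof (rule eq_0_if_orthogonal)
    fix v
    obtain a b where "a \<in> X" "b \<in> Y" "v = a + b" using dec by blast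
    then show "B x v = 0" using orth[of a x] orth[of x b] x by (simp add: B_simps B_sym[of x a])
  qed
  obtain p where p: "\<And>v. p v \<in> X \<and> v - p v \<in> Y"
    using dec by (metis add_diff_cancel_left')
  have p_eq: "p v = x" if "x \<in> X" "v - x \<in> Y" for v x
  proof -
    have "p v - x \<in> X" using vec.subspace_diff[OF X] p that by blast
    moreover have "(v - x) - (v - p v) \<in> Y" using vec.subspace_diff[OF Y] p that by blast
    ultimately show ?thesis using X0[of "p v - x"] by simp
  qed
  define s where "s v = p v + p v - v" for v
  have s: "s (x + y) = x - y" if "x \<in> X" "y \<in> Y" for x y
    using p_eq[of x "x + y"] that by (simp add: s_def)
  have lin: "lin s"
  proof (rule linI)
    fix v w
    obtain x y x' y' where v: "v = x + y" "x \<in> X" "y \<in> Y" "w = x' + y'" "x' \<in> X" "y' \<in> Y"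
      using dec by metis
    have "v + w = (x + x') + (y + y')" by (simp add: v)
    then have "s (v + w) = (x + x') - (y + y')"
      using s[of "x + x'" "y + y'"] v vec.subspace_add[OF X] vec.subspace_add[OF Y] by metis
    then show "s (v + w) = s v + s w" using s v by simp
  next
    fix a v
    obtain x y where v: "v = x + y" "x \<in> X" "y \<in> Y" using dec by metis
    have "a *s v = a *s x + a *s y" by (simp add: v scale_simps)
    then have "s (a *s v) = a *s x - a *s y"
      using s[of "a *s x" "a *s y"] v vec.subspace_scale[OF X] vec.subspace_scale[OF Y] by simp
    then show "s (a *s v) = a *s s v" using s v by (simp add: scale_simps)
  qed
  have "B (s v) (s w) = B v w" for v w
  proof -
    obtain x y x' y' where v: "v = x + y" "x \<in> X" "y \<in> Y" "w = x' + y'" "x' \<in> X" "y' \<in> Y"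
      using dec by metis
    have "B x y' = 0" "B y x' = 0" using orth[of x y'] orth[of x' y] v by (simp_all add: B_sym[of y])
    then show ?thesis using v s by (simp add: B_simps)
  qed
  with lin have "isometry s" by (rule isometryI)
  then show ?thesis using s by blast
qed

lemma skew_pair_isometry:
  assumes g: "isometry g"
  shows "skew_pair Q (\<lambda>x. g x + inv_map g x) (\<lambda>x. g x - inv_map g x)"
proof (rule skew_pair.intro[OF quadratic_space_axioms], rule skew_pair_axioms.intro)
  note g' = isometry_inv[OF g]
  note l = lin_simps[OF isometry_lin[OF g]] lin_simps[OF isometry_lin[OF g']]
  show "lin (\<lambda>x. g x + inv_map g x)" "lin (\<lambda>x. g x - inv_map g x)"
    by (rule linI; simp add: l scale_simps)+
  have adj: "B (inv_map g x) y = B x (g y)" for x y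
    by (metis g isometry_adj B_sym)
  show "B (g x + inv_map g x) y = B x (g y + inv_map g y)" "B (g x - inv_map g x) y = - B x (g y - inv_map g y)" for x y
    by (simp_all add: B_simps isometry_adj[OF g] adj)
  show "g (g x - inv_map g x) + inv_map g (g x - inv_map g x) = g (g x + inv_map g x) - inv_map g (g x + inv_map g x)" for x
    by (simp add: l isometry_inv_simps[OF g])
  show "g (g x - inv_map g x) - inv_map g (g x - inv_map g x) = g (g x + inv_map g x) + inv_map g (g x + inv_map g x) - 4 *s x" for x
  proof -
    have "4 *s x = x + x + x + x"
      by (simp add: vec_eq_iff)
    then show ?thesis by (simp add: l isometry_inv_simps[OF g] algebra_simps)
  qed
qed

text \<open>
  The operators \<open>c\<close> and \<open>d\<close> preserve the eigenspaces \<open>V 1\<close> and \<open>V (-1)\<close> of \<open>t\<close>, which are orthogonal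
  complements, so each of them can be graded separately. For \<open>t = 1\<close> this is Wonenburger's theorem.
\<close>

lemma commuting_inverting_involution:
  assumes g: "isometry g" and t: "isometry t" "\<And>x. t (t x) = x" and gt: "\<And>x. g (t x) = t (g x)"
  shows "\<exists>s. isometry s \<and> (\<forall>x. s (s x) = x) \<and> (\<forall>x. g (s (g x)) = s x) \<and> (\<forall>x. s (t x) = t (s x))"
proof -
  define c where "c = (\<lambda>x. g x + inv_map g x)"
  define d where "d = (\<lambda>x. g x - inv_map g x)"
  interpret skew_pair Q c d
    unfolding c_def d_def by (rule skew_pair_isometry[OF g])
  note tl = lin_simps[OF isometry_lin[OF t(1)]]
  have igt: "inv_map g (t x) = t (inv_map g x)" for x
    by (metis g gt isometry_inv_simps)
  have ct: "c (t x) = t (c x)" and dt: "d (t x) = t (d x)" for x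
    by (simp_all add: c_def d_def gt igt tl)
  define V where "V e = {x. t x = e *s x}" for e
  define h where "h = (1/2 :: 'a)"
  have h: "h + h = 1" using two_neq_0 by (simp add: h_def flip: mult_2)
  have hx: "x = h *s x + h *s x" for x by (metis h vec.scale_left_distrib vec.scale_one)
  have V: "invariant (V e)" for e
    unfolding invariant_def V_def
    by (auto simp: tl lin_simps[OF lin_c] lin_simps[OF lin_d] scale_simps simp flip: ct dt
        intro!: vec.subspaceI)
  have orthV: "B x y = 0" if "x \<in> V 1" "y \<in> V (-1)" for x y
  proof -
    have "B x y = B (t x) (t y)" by (simp add: isometry_B[OF t(1)])
    also have "\<dots> = - B x y" using that by (simp add: V_def B_simps)
    finally have "2 * B x y = 0" by simp
    then show ?thesis using two_neq_0 by simp
  qed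
  have decV: "\<exists>x\<in>V 1. \<exists>y\<in>V (-1). v = x + y" for v
  proof (intro bexI)
    show "v = h *s (v + t v) + h *s (v - t v)" using hx[of v] by (simp add: scale_simps)
  qed (auto simp: V_def tl t(2) scale_simps add.commute)
  have nd: "nondegenerate_on (V 1)" "nondegenerate_on (V (-1))"
    unfolding nondegenerate_on_def
  proof safe
    fix x assume x: "x \<in> V 1" "\<forall>y\<in>V 1. B x y = 0"
    show "x = 0"
    proof (rule eq_0_if_orthogonal)
      fix v obtain a b where "a \<in> V 1" "b \<in> V (-1)" "v = a + b" using decV by blast
      then show "B x v = 0" using x orthV by (simp add: B_simps)
    qed
  next
    fix x assume x: "x \<in> V (-1)" "\<forall>y\<in>V (-1). B x y = 0"
    show "x = 0"
    proof (rule eq_0_if_orthogonal)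
      fix v obtain a b where "a \<in> V 1" "b \<in> V (-1)" "v = a + b" using decV by blast
      then show "B x v = 0" using x orthV[of a x] by (simp add: B_simps B_sym[of x a])
    qed
  qed
  obtain X1 Y1 where g1: "graded X1 Y1" "V 1 = {x + y | x y. x \<in> X1 \<and> y \<in> Y1}"
    using nondegenerate_imp_gradable[OF V nd(1)] by (auto simp: gradable_def)
  obtain X2 Y2 where g2: "graded X2 Y2" "V (-1) = {x + y | x y. x \<in> X2 \<and> y \<in> Y2}"
    using nondegenerate_imp_gradable[OF V nd(2)] by (auto simp: gradable_def)
  let ?X = "{u + v | u v. u \<in> X1 \<and> v \<in> X2}"
  let ?Y = "{u + v | u v. u \<in> Y1 \<and> v \<in> Y2}"
  have gr: "graded ?X ?Y" using orthV unfolding g1(2) g2(2) by (rule graded_sum[OF g1(1) g2(1)])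
  have dec4: "\<exists>x1\<in>X1. \<exists>y1\<in>Y1. \<exists>x2\<in>X2. \<exists>y2\<in>Y2. v = (x1 + x2) + (y1 + y2)" for v
  proof -
    obtain a b where ab: "a \<in> V 1" "b \<in> V (-1)" "v = a + b" using decV by blast
    obtain x1 y1 where 1: "a = x1 + y1" "x1 \<in> X1" "y1 \<in> Y1" using ab g1 by blast
    obtain x2 y2 where 2: "b = x2 + y2" "x2 \<in> X2" "y2 \<in> Y2" using ab g2 by blast
    have "v = (x1 + x2) + (y1 + y2)" using ab 1 2 by (simp add: algebra_simps)
    then show ?thesis using 1 2 by blast
  qed
  obtain s where s: "isometry s" "\<And>x y. x \<in> ?X \<Longrightarrow> y \<in> ?Y \<Longrightarrow> s (x + y) = x - y"
  proof -
    have "\<exists>s. isometry s \<and> (\<forall>x\<in>?X. \<forall>y\<in>?Y. s (x + y) = x - y)"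
    proof (rule orthogonal_sign_change)
      show "vec.subspace ?X" "vec.subspace ?Y" using gr unfolding graded_def by blast+
      show "B x y = 0" if "x \<in> ?X" "y \<in> ?Y" for x y using gr that unfolding graded_def by blast
      show "\<exists>x\<in>?X. \<exists>y\<in>?Y. v = x + y" for v using dec4[of v] by blast
    qed
    then show thesis using that by blast
  qed
  note sl = lin_simps[OF isometry_lin[OF s(1)]]
  have "vec.subspace ?X" "vec.subspace ?Y" using gr unfolding graded_def by blast+
  then have zX: "0 \<in> ?X" and zY: "0 \<in> ?Y" using vec.subspace_0[of ?X] vec.subspace_0[of ?Y] by argo+
  have sX: "s x = x" if "x \<in> ?X" for x using s(2)[OF that zY] by simp
  have sY: "s y = - y" if "y \<in> ?Y" for y using s(2)[OF zX that] by simp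
  have z4: "0 \<in> X1" "0 \<in> X2" "0 \<in> Y1" "0 \<in> Y2"
    using g1(1) g2(1) by (auto simp: graded_def vec.subspace_0)
  have memX: "x \<in> X1 \<Longrightarrow> x \<in> ?X" "x \<in> X2 \<Longrightarrow> x \<in> ?X" and memY: "x \<in> Y1 \<Longrightarrow> x \<in> ?Y" "x \<in> Y2 \<Longrightarrow> x \<in> ?Y" for x
    using z4 by (force intro: exI[of _ 0])+
  have dec: "\<exists>x\<in>?X. \<exists>y\<in>?Y. v = x + y" for v using dec4[of v] by blast
  have "s (s v) = v" for v
  proof -
    obtain x y where "x \<in> ?X" "y \<in> ?Y" "v = x + y" using dec by blast
    then show ?thesis by (simp only: sl sX sY) simp
  qed
  moreover have "g (s (g v)) = s v" for v
  proof -
    obtain x y where xy: "x \<in> ?X" "y \<in> ?Y" "v = x + y" using dec by blast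
    have mem: "c x \<in> ?X" "d x \<in> ?Y" "c y \<in> ?Y" "d y \<in> ?X"
      using gr xy unfolding graded_def by blast+
    have two: "2 *s w = w + w" for w :: "'a ^ 'n" by (simp add: vec_eq_iff)
    have "2 *s g v = c x + d x + (c y + d y)"
      by (simp add: two c_def d_def xy(3) lin_simps[OF isometry_lin[OF g]])
    then have "2 *s s (g v) = s (c x + d x + (c y + d y))" by (metis sl(2))
    also have "\<dots> = c x - d x + (- c y + d y)"
      by (simp only: sl mem sX sY) simp
    also have "\<dots> = 2 *s inv_map g (s v)"
      by (simp add: two c_def d_def xy sl sX[OF xy(1)] sY[OF xy(2)] lin_simps[OF isometry_lin[OF isometry_inv[OF g]]])
    finally have "s (g v) = inv_map g (s v)" using two_neq_0 by simp
    then show ?thesis by (simp add: isometry_inv_simps[OF g])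
  qed
  moreover have "s (t v) = t (s v)" for v
  proof -
    obtain x1 y1 x2 y2 where v: "x1 \<in> X1" "y1 \<in> Y1" "x2 \<in> X2" "y2 \<in> Y2" "v = (x1 + x2) + (y1 + y2)"
      using dec4[of v] by blast
    have "x1 + 0 \<in> V 1" "0 + y1 \<in> V 1" "x2 + 0 \<in> V (-1)" "0 + y2 \<in> V (-1)"
      unfolding g1(2) g2(2) using v z4 by blast+
    then have tt: "t x1 = x1" "t y1 = y1" "t x2 = - x2" "t y2 = - y2" by (simp_all add: V_def)
    have ss: "s x1 = x1" "s y1 = - y1" "s x2 = x2" "s y2 = - y2"
      using v memX memY sX sY by blast+
    show ?thesis by (simp add: v(5) sl tl tt ss)
  qed
  ultimately show ?thesis using s(1) by blast
qed

lemma det_compose: "lin f \<Longrightarrow> lin g \<Longrightarrow> det (matrix (f \<circ> g)) = det (matrix f) * det (matrix g)"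
  for f g :: "'a ^ 'n \<Rightarrow> 'a ^ 'n"
  by (simp add: matrix_compose_gen det_mul)

lemma B_sum_left: "B (sum f S) x = (\<Sum>i\<in>S. B (f i) x)"
  by (induction S rule: infinite_finite_induct) (simp_all add: B_simps)

text \<open>
  The matrices of adjoint maps are conjugate up to transposition by the Gram matrix, which is the
  matrix of \<open>\<phi>\<close>.
\<close>

lemma det_adjoint:
  assumes f: "lin f" and h: "lin h" and adj: "\<And>x y. B (f x) y = B x (h y)"
  shows "det (matrix f) = det (matrix h)"
proof -
  define \<phi> where "\<phi> x = (\<chi> i. B (axis i 1) x)" for x
  have lin: "lin \<phi>" by (rule linI) (simp_all add: \<phi>_def vec_eq_iff B_simps)
  have expand: "B v x = (\<Sum>k\<in>UNIV. v $ k * \<phi> x $ k)" for v x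
  proof -
    have "B v x = B (\<Sum>k\<in>UNIV. v $ k *s axis k 1) x" by (simp add: basis_expansion)
    then show ?thesis by (simp add: B_sum_left B_simps \<phi>_def)
  qed
  have "inj \<phi>"
  proof (rule injI)
    fix x y assume "\<phi> x = \<phi> y"
    then have "B v x = B v y" for v by (simp add: expand)
    then have "B (x - y) v = 0" for v by (simp add: B_sym[of _ v] B_simps)
    then show "x = y" using eq_0_if_orthogonal[of "x - y"] by simp
  qed
  then have nz: "det (matrix \<phi>) \<noteq> 0" using det_nz_iff_inj_gen[OF lin] by simp
  have "\<phi> \<circ> h = (*v) (transpose (matrix f)) \<circ> \<phi>"
  proof (rule ext, simp only: vec_eq_iff comp_apply, rule allI)
    fix x i
    have "\<phi> (h x) $ i = B (f (axis i 1)) x" by (simp add: \<phi>_def adj)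
    also have "\<dots> = (\<Sum>k\<in>UNIV. f (axis i 1) $ k * \<phi> x $ k)" by (rule expand)
    also have "\<dots> = (transpose (matrix f) *v \<phi> x) $ i"
      by (simp add: matrix_vector_mult_def transpose_def matrix_def)
    finally show "\<phi> (h x) $ i = (transpose (matrix f) *v \<phi> x) $ i" .
  qed
  then have "det (matrix \<phi>) * det (matrix h) = det (transpose (matrix f)) * det (matrix \<phi>)"
    by (metis det_compose[OF lin h] det_compose[OF _ lin] matrix_of_matrix_vector_mul matrix_vector_mul_linear_gen)
  then show ?thesis using nz by (simp add: det_transpose)
qed

lemma det_isometry_inv:
  assumes "isometry f"
  shows "det (matrix f) * det (matrix (inv_map f)) = 1" "det (matrix (inv_map f)) = det (matrix f)"
proof -
  have "f \<circ> inv_map f = id" using isometry_inv_simps[OF assms] by auto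
  then show "det (matrix f) * det (matrix (inv_map f)) = 1"
    by (metis assms det_I det_compose isometry_inv isometry_lin matrix_id_mat_1 id_def)
  show "det (matrix (inv_map f)) = det (matrix f)"
    by (rule sym, rule det_adjoint) (intro isometry_lin isometry_inv assms isometry_adj)+
qed

lemma det_isometry: "isometry f \<Longrightarrow> det (matrix f) = 1 \<or> det (matrix f) = - 1"
  using det_isometry_inv[of f] by (simp add: square_eq_1_iff)

text \<open>
  Take determinants in \<open>f + 1 = f (f\<^sup>-\<^sup>1 + 1)\<close>: the maps \<open>f\<^sup>-\<^sup>1 + 1\<close> and \<open>f + 1\<close> are adjoint and so
  have the same determinant, which is nonzero.
\<close>

lemma det_eq_1_if_inj_add_id:
  assumes f: "isometry f" and inj: "inj (\<lambda>x. f x + x)"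
  shows "det (matrix f) = 1"
proof -
  note l = lin_simps[OF isometry_lin[OF f]] lin_simps[OF isometry_lin[OF isometry_inv[OF f]]]
  have lin: "lin (\<lambda>x. f x + x)" "lin (\<lambda>x. inv_map f x + x)"
    by (rule linI; simp add: l scale_simps)+
  have "(\<lambda>x. f x + x) = f \<circ> (\<lambda>x. inv_map f x + x)"
    by (auto simp: l isometry_inv_simps[OF f])
  from arg_cong[OF this, of "\<lambda>f. det (matrix f)"]
  have "det (matrix (\<lambda>x. f x + x)) = det (matrix f) * det (matrix (\<lambda>x. inv_map f x + x))"
    unfolding det_compose[OF isometry_lin[OF f] lin(2)] .
  moreover have "det (matrix (\<lambda>x. f x + x)) = det (matrix (\<lambda>x. inv_map f x + x))"
    by (intro det_adjoint lin) (simp add: B_simps isometry_adj[OF f])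
  ultimately show ?thesis using det_nz_iff_inj_gen[OF lin(1)] inj by simp
qed

text \<open>
  The operator \<open>a = z + z\<^sup>-\<^sup>1 + 2 = z\<^sup>-\<^sup>1 (z + 1)\<^sup>2\<close> is self-adjoint, and its idempotent power \<open>E\<close> projects
  onto the complement of the generalised eigenspace of \<open>z\<close> for \<open>-1\<close>. The isometry \<open>t z\<close> with
  \<open>t = 2 E - 1\<close> agrees with \<open>z\<close> where \<open>z + 1\<close> is invertible and with \<open>-z\<close> where \<open>z + 1\<close> is nilpotent.
  It therefore does not have eigenvalue \<open>-1\<close>, which forces its determinant to be 1.
\<close>

lemma commuting_involution_det_minus_1:
  assumes z: "isometry z" and det: "det (matrix z) = -1" and g: "isometry g" and gz: "\<And>x. g (z x) = z (g x)"
  shows "\<exists>t. isometry t \<and> (\<forall>x. t (t x) = x) \<and> (\<forall>x. g (t x) = t (g x)) \<and> det (matrix t) = -1"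
proof -
  note z' = isometry_inv[OF z]
  note zl = lin_simps[OF isometry_lin[OF z]] lin_simps[OF isometry_lin[OF z']]
  note gl = lin_simps[OF isometry_lin[OF g]]
  define a where "a x = z x + inv_map z x + 2 *s x" for x
  have la: "lin a" unfolding a_def by (rule linI) (simp_all add: zl scale_simps mult.commute)
  have a_adj: "B (a x) y = B x (a y)" for x y
    unfolding a_def using isometry_adj[OF z] isometry_adj[OF z] B_sym by (simp add: B_simps)
  have az: "z (a x) = a (z x)" for x
    by (simp add: a_def zl isometry_inv_simps[OF z])
  have "inv_map z (g x) = g (inv_map z x)" for x by (metis gz isometry_inv_simps[OF z])
  then have ga: "g (a x) = a (g x)" for x by (simp add: a_def gz gl)
  obtain k where k: "k > 0" "a ^^ (k + k) = a ^^ k" using idempotent_power by blast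
  have powl: "lin (a ^^ m)" for m
    by (induction m) (auto simp: vec.linear_id[unfolded id_def] intro!: linI simp: lin_simps[OF la] lin_simps)
  define E where "E = a ^^ k"
  have lE: "lin E" by (simp add: E_def powl)
  note El = lin_simps[OF lE]
  have E2: "E (2 * x) = 2 * E x" for x by (simp only: mult_2 El)
  have EE: "E (E x) = E x" for x using k(2) by (metis E_def comp_apply funpow_add)
  have "B ((a ^^ m) x) y = B x ((a ^^ m) y)" for m x y
    by (induction m arbitrary: x y) (simp_all add: a_adj funpow_swap1)
  then have E_adj: "B (E x) y = B x (E y)" for x y by (simp add: E_def)
  have "z ((a ^^ m) x) = (a ^^ m) (z x)" "g ((a ^^ m) x) = (a ^^ m) (g x)" for m x
    by (induction m) (simp_all add: az ga)
  then have Ez: "z (E x) = E (z x)" and Eg: "g (E x) = E (g x)" for x by (simp_all add: E_def)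
  define t where "t x = E x + E x - x" for x
  have lt: "lin t" unfolding t_def by (rule linI) (simp_all add: El scale_simps, simp add: vec_eq_iff)
  have tt: "t (t x) = x" for x by (simp add: t_def El EE E2)
  have "B (t x) y = B x (t y)" for x y by (simp only: t_def B_simps E_adj)
  then have "isometry t" using lt tt by (intro isometryI) simp_all
  have gt: "g (t x) = t (g x)" for x by (simp only: t_def gl Eg)
  have kernel: "E x = 0" if "a x = 0" for x
  proof -
    have "E x = (a ^^ (k - 1)) (a x)"
      unfolding E_def using k(1) by (metis Suc_diff_1 comp_apply funpow_Suc_right)
    then show ?thesis using that lin_zero[OF powl] by simp
  qed
  have "inj (\<lambda>x. (t \<circ> z) x + x)"
  proof (rule injI)
    fix x y assume eq: "(t \<circ> z) x + x = (t \<circ> z) y + y"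
    \<comment> \<open>On the kernel vector \<open>w\<close> of \<open>t z + 1\<close> the components \<open>E w\<close> and \<open>w - E w\<close> vanish separately: the
      first is a kernel vector of \<open>a\<close>, the second an eigenvector of \<open>a\<close> for \<open>4\<close>.\<close>
    define w where "w = x - y"
    have "t (z w) + w = ((t \<circ> z) x + x) - ((t \<circ> z) y + y)"
      by (simp add: w_def lin_simps[OF lt] zl)
    then have w: "t (z w) = - w" unfolding eq by (simp add: add_eq_0_iff2)
    define u where "u = E w"
    have "E (t (z w)) = z (E w)" by (simp add: t_def El EE E2 Ez)
    then have "z u = - u" using w by (simp add: u_def El)
    moreover from this have "inv_map z u = - u" by (metis isometry_inv_simps(2)[OF z] minus_minus zl(9))
    ultimately have "a u = - u + - u + 2 *s u" by (simp add: a_def)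
    also have "\<dots> = 0" by (simp add: vec_eq_iff)
    finally have "a u = 0" .
    then have "E u = 0" by (rule kernel)
    then have u0: "E w = 0" by (simp add: u_def EE)
    have "E (z w) = 0" using u0 by (simp add: lin_zero[OF isometry_lin[OF z]] flip: Ez)
    then have "z w = w" using w by (simp add: t_def)
    moreover from this have "inv_map z w = w" by (metis isometry_inv_simps(2)[OF z])
    ultimately have "a w = (2 + 2) *s w" by (simp add: a_def vec_eq_iff distrib_right)
    moreover have "(2::'a) + 2 \<noteq> 0" using two_neq_0 by (simp only: mult_2[symmetric] mult_eq_0_iff) simp
    ultimately obtain q where q: "a w = q *s w" "q \<noteq> 0" by blast
    have "(a ^^ m) w = (q ^ m) *s w" for m
      by (induction m) (simp_all add: lin_simps[OF la] q(1) mult.commute)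
    then have "q ^ k *s w = 0" using u0 by (simp add: E_def)
    then have "w = 0" using q(2) by simp
    then show "x = y" by (simp add: w_def)
  qed
  then have "det (matrix (t \<circ> z)) = 1"
    by (intro det_eq_1_if_inj_add_id isometry_comp \<open>isometry t\<close> z)
  then have "det (matrix t) = -1"
    using det by (simp add: det_compose lt isometry_lin z minus_equation_iff)
  then show ?thesis using \<open>isometry t\<close> tt gt by blast
qed

text \<open>
  An involution \<open>s\<close> that inverts \<open>g\<close> and has determinant \<open>-1\<close> differs from \<open>h\<close> by an isometry of
  determinant \<open>-1\<close> commuting with \<open>g\<close>. This yields an involution \<open>t\<close> with the same two properties, and
  an inverting involution that commutes with \<open>t\<close> can be multiplied by \<open>t\<close> to change its determinant.
\<close>

lemma special_inverting_involution:
  assumes g: "isometry g" and h: "isometry h" "det (matrix h) = 1" and gh: "\<And>x. g (h (g x)) = h x"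
  shows "\<exists>s. isometry s \<and> (\<forall>x. s (s x) = x) \<and> (\<forall>x. g (s (g x)) = s x) \<and> det (matrix s) = 1"
proof -
  obtain s where s: "isometry s" "\<And>x. s (s x) = x" "\<And>x. g (s (g x)) = s x"
    using commuting_inverting_involution[OF g isometry_id] by auto
  show ?thesis
  proof (cases "det (matrix s) = 1")
    case False
    then have det: "det (matrix (s \<circ> h)) = -1"
      using det_isometry[OF s(1)] h by (simp add: det_compose isometry_lin s)
    have "g ((s \<circ> h) x) = (s \<circ> h) (g x)" for x
      using s(3)[of "h (g x)"] by (simp add: gh)
    from commuting_involution_det_minus_1[OF isometry_comp[OF s(1) h(1)] det g this]
    obtain t where t: "isometry t" "\<And>x. t (t x) = x" "\<And>x. g (t x) = t (g x)" "det (matrix t) = -1" by blast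
    from commuting_inverting_involution[OF g t(1-3)]
    obtain r where r: "isometry r" "\<And>x. r (r x) = x" "\<And>x. g (r (g x)) = r x" "\<And>x. r (t x) = t (r x)" by blast
    show ?thesis
    proof (cases "det (matrix r) = 1")
      case False
      then have "det (matrix (r \<circ> t)) = 1"
        using det_isometry[OF r(1)] t by (simp add: det_compose isometry_lin r)
      moreover have "isometry (r \<circ> t)" by (intro isometry_comp r t)
      moreover have "g ((r \<circ> t) (g x)) = (r \<circ> t) x" for x
        using r(3)[of "t x"] by (simp add: t(3))
      moreover have "(r \<circ> t) ((r \<circ> t) x) = x" for x
        by (simp add: r(2) t(2) flip: r(4))
      ultimately show ?thesis
        by blast
    qed (use r in blast)
  qed (use s in blast)
qed

end

section \<open>Squares in finite fields of odd order\<close>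

lemma even_card_if_fixpoint_free_involution:
  assumes "finite S" "\<And>x. x \<in> S \<Longrightarrow> f x \<in> S \<and> f (f x) = x \<and> f x \<noteq> x"
  shows "even (card S)"
  using assms
proof (induction S rule: finite_psubset_induct)
  case (psubset S)
  show ?case
  proof (cases "S = {}")
    case False
    then obtain x where x: "x \<in> S" by blast
    note fx = psubset.prems[OF x]
    have "f y \<in> S - {x, f x}" if "y \<in> S - {x, f x}" for y
      using that psubset.prems[of y] fx by (metis Diff_iff insert_iff empty_iff)
    then have "even (card (S - {x, f x}))"
      using psubset.prems x by (intro psubset.IH) blast+
    moreover have "card S = card (S - {x, f x}) + card (S \<inter> {x, f x})"
      by (metis add.commute card_Int_Diff psubset.hyps)
    moreover have "S \<inter> {x, f x} = {x, f x}" using x fx by blast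
    moreover have "card {x, f x} = 2" using fx by (simp add: eq_commute[of x])
    ultimately show ?thesis by simp
  qed simp
qed

lemma two_neq_0_if_odd_card:
  assumes "odd CARD('a::{field,finite})"
  shows "(2::'a) \<noteq> 0"
proof
  assume "(2::'a) = 0"
  then have "(1::'a) + 1 = 0" by simp
  then have "(x + 1) + 1 = x" for x :: 'a by (simp only: add.assoc) simp
  then have "even CARD('a)" by (intro even_card_if_fixpoint_free_involution[of _ "\<lambda>x. x + 1"]) auto
  with assms show False by simp
qed

definition is_sqr :: "'a::field \<Rightarrow> bool" where "is_sqr a \<longleftrightarrow> (\<exists>b. a = b * b)"

definition nonzero_squares :: "'a::field set" where
  "nonzero_squares = (\<lambda>x. x * x) ` (UNIV - {0})"

lemma is_sqr_iff: "a \<noteq> 0 \<Longrightarrow> is_sqr a \<longleftrightarrow> a \<in> nonzero_squares"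
  by (auto simp: is_sqr_def nonzero_squares_def)

lemma card_nonzero_squares:
  assumes "(2::'a::{field,finite}) \<noteq> 0"
  shows "card (UNIV - {0::'a}) = 2 * card (nonzero_squares :: 'a set)"
proof -
  have fib: "card {x \<in> UNIV - {0}. x * x = y} = 2" if "y \<in> nonzero_squares" for y :: 'a
  proof -
    obtain x0 where x0: "y = x0 * x0" "x0 \<noteq> 0" using \<open>y \<in> nonzero_squares\<close> by (auto simp: nonzero_squares_def)
    have "x0 + x0 \<noteq> 0" using assms x0(2) by (simp flip: mult_2)
    then have "x0 \<noteq> - x0" by (metis add.right_inverse)
    moreover have "{x \<in> UNIV - {0}. x * x = y} = {x0, - x0}"
      using x0 by (auto simp: square_eq_iff)
    ultimately show ?thesis by simp
  qed
  have "card (UNIV - {0::'a}) = (\<Sum>x\<in>UNIV - {0::'a}. 1)" by simp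
  also have "\<dots> = (\<Sum>y\<in>nonzero_squares. \<Sum>x | x \<in> UNIV - {0::'a} \<and> x * x = y. 1)"
    unfolding nonzero_squares_def by (rule sum.image_gen) simp
  also have "\<dots> = (\<Sum>y\<in>(nonzero_squares :: 'a set). 2)"
    using fib by (intro sum.cong refl) simp
  finally show ?thesis by simp
qed

text \<open>
  The nonzero squares have index 2 in the multiplicative group.
\<close>

lemma nonsquare_ratio:
  fixes a b :: "'a::{field,finite}"
  assumes two: "(2::'a) \<noteq> 0" and a: "\<not> is_sqr a" and b: "\<not> is_sqr b"
  shows "\<exists>c. c \<noteq> 0 \<and> b = a * (c * c)"
proof -
  have nz: "a \<noteq> 0" "b \<noteq> 0" using a b by (auto simp: is_sqr_def)
  let ?S = "nonzero_squares :: 'a set"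
  have disj: "(*) a ` ?S \<inter> ?S = {}"
  proof (rule ccontr)
    assume "\<not> ?thesis"
    then obtain x y where "a * (x * x) = y * y" "x \<noteq> 0" by (auto simp: nonzero_squares_def)
    then have "a = (y / x) * (y / x)" by (simp add: field_simps)
    with a show False unfolding is_sqr_def by blast
  qed
  have "card ((*) a ` ?S \<union> ?S) = card ?S + card ?S"
    using nz disj by (subst card_Un_disjoint) (auto simp: card_image inj_on_def)
  then have "card ((*) a ` ?S \<union> ?S) = card (UNIV - {0::'a})"
    using card_nonzero_squares[OF two] by simp
  moreover have "(*) a ` ?S \<union> ?S \<subseteq> UNIV - {0}" using nz by (auto simp: nonzero_squares_def)
  ultimately have "(*) a ` ?S \<union> ?S = UNIV - {0}" by (intro card_subset_eq) auto
  then have "b \<in> (*) a ` ?S \<union> ?S" using nz by auto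
  then show ?thesis using b nz is_sqr_iff[of b] by (auto simp: nonzero_squares_def)
qed

text \<open>
  Inversion on the group of nonzero squares fixes \<open>1\<close> and, if it is a square, \<open>-1\<close>. So \<open>-1\<close> is a
  square if and only if the order \<open>(q - 1) / 2\<close> of this group is even.
\<close>

lemma is_sqr_minus_1_iff:
  assumes odd: "odd CARD('a::{field,finite})"
  shows "is_sqr (- 1 :: 'a) \<longleftrightarrow> CARD('a) mod 4 = 1"
proof -
  have two: "(2::'a) \<noteq> 0" by (rule two_neq_0_if_odd_card[OF odd])
  have "(1::'a) + 1 \<noteq> 0" using two by simp
  then have ne: "(-1::'a) \<noteq> 1" by (metis add.right_inverse)
  let ?S = "nonzero_squares :: 'a set"
  have one: "1 \<in> ?S" unfolding nonzero_squares_def by (rule image_eqI[of _ _ 1]) auto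
  have "even (card (?S - {1, -1}))"
  proof (rule even_card_if_fixpoint_free_involution)
    fix x :: 'a assume "x \<in> ?S - {1, - 1}"
    then obtain y where y: "y \<noteq> 0" "x = y * y" "x \<noteq> 1" "x \<noteq> - 1" by (auto simp: nonzero_squares_def)
    have "inverse x \<in> ?S"
      unfolding nonzero_squares_def by (rule image_eqI[of _ _ "inverse y"]) (use y in auto)
    moreover have "inverse x \<noteq> x"
    proof
      assume "inverse x = x"
      moreover have "x \<noteq> 0" using y by simp
      then have "inverse x * x = 1" by (rule left_inverse)
      ultimately have "x * x = 1" by simp
      then show False using y(3,4) by (simp add: square_eq_1_iff)
    qed
    moreover have "inverse x \<noteq> 1" using y(3) by simp
    moreover have "inverse x \<noteq> - 1" using y(4) by (metis inverse_inverse_eq inverse_minus_eq inverse_1)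
    ultimately show "inverse x \<in> ?S - {1, - 1} \<and> inverse (inverse x) = x \<and> inverse x \<noteq> x" by simp
  qed simp
  moreover have "card ?S = card (?S - {1, -1}) + card (?S \<inter> {1, -1})"
    by (metis add.commute card_Int_Diff finite)
  moreover have "?S \<inter> {1, -1} = (if -1 \<in> ?S then {1, -1} else {1})" using one by auto
  ultimately have *: "even (card ?S) \<longleftrightarrow> -1 \<in> ?S" using ne by (auto split: if_splits)
  have "CARD('a) = Suc (card (UNIV - {0::'a}))"
    by (rule card.remove) auto
  then have "CARD('a) = 2 * card ?S + 1"
    using card_nonzero_squares[OF two] by simp
  moreover have "(2 * k + 1) mod 4 = 1 \<longleftrightarrow> even k" for k :: nat by presburger
  ultimately have "CARD('a) mod 4 = 1 \<longleftrightarrow> even (card ?S)" by metis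
  then show ?thesis using * is_sqr_iff[of "-1::'a"] by simp
qed

section \<open>Orthogonal families\<close>

context quadratic_space
begin

definition orthogonal_family :: "nat \<Rightarrow> (nat \<Rightarrow> 'a ^ 'n) \<Rightarrow> bool" where
  "orthogonal_family k v \<longleftrightarrow> (\<forall>i<k. Q (v i) \<noteq> 0 \<and> (\<forall>j<k. i \<noteq> j \<longrightarrow> B (v i) (v j) = 0))"

lemma B_sum_right: "B x (sum f S) = (\<Sum>i\<in>S. B x (f i))"
  by (simp add: B_sym[of x] B_sum_left)

lemma orthogonal_family_coeff:
  assumes v: "orthogonal_family k v" and i: "i < k"
  shows "B (\<Sum>j<k. a j *s v j) (v i) = a i * Q (v i)"
proof -
  have "B (\<Sum>j<k. a j *s v j) (v i) = (\<Sum>j<k. if j = i then a i * Q (v i) else 0)"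
    unfolding B_sum_left using v i by (intro sum.cong refl) (auto simp: B_simps B_self orthogonal_family_def)
  then show ?thesis using i by simp
qed

text \<open>
  By counting, fewer than \<open>n\<close> linear conditions have a nonzero common solution. The solution space is
  nondegenerate because the family is anisotropic.
\<close>

lemma orthogonal_family_extend_one:
  assumes v: "orthogonal_family k v" and k: "k < CARD('n)"
  shows "\<exists>w. Q w \<noteq> 0 \<and> (\<forall>i<k. B w (v i) = 0)"
proof -
  define P where "P = {x. \<forall>i<k. B x (v i) = 0}"
  have P: "vec.subspace P" unfolding P_def by (rule vec.subspaceI) (auto simp: B_simps)
  have nd: "nondegenerate_on P"
    unfolding nondegenerate_on_def
  proof (intro ballI impI, rule eq_0_if_orthogonal)
    fix x z assume x: "x \<in> P" "\<forall>y\<in>P. B x y = 0"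
    define s where "s = (\<Sum>j<k. (B z (v j) / Q (v j)) *s v j)"
    have "B (z - s) (v i) = 0" if "i < k" for i
      using orthogonal_family_coeff[OF v that, of "\<lambda>j. B z (v j) / Q (v j)"] v that
      by (simp add: s_def B_simps orthogonal_family_def)
    then have "B x (z - s) = 0" using x by (simp add: P_def)
    moreover have "B x s = 0" using x by (simp add: s_def B_sum_right B_simps P_def)
    ultimately show "B x z = 0" by (simp add: B_simps)
  qed
  let ?h = "\<lambda>x. restrict (\<lambda>i. B x (v i)) {..<k}"
  have "\<not> inj ?h"
  proof
    assume "inj ?h"
    then have "CARD('a ^ 'n) \<le> card (PiE {..<k} (\<lambda>_. UNIV :: 'a set))"
      by (rule card_inj_on_le) (simp_all add: finite_PiE image_subset_iff)
    then have "CARD('a) ^ CARD('n) \<le> CARD('a) ^ k" by (simp add: card_PiE)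
    moreover have "card {0, 1::'a} \<le> CARD('a)" by (intro card_mono) auto
    then have "CARD('a) ^ k < CARD('a) ^ CARD('n)" using k by (intro power_strict_increasing) auto
    ultimately show False by simp
  qed
  then obtain x y where xy: "x \<noteq> y" "?h x = ?h y" by (auto simp: inj_def)
  have "B (x - y) (v i) = 0" if "i < k" for i
    using fun_cong[OF xy(2), of i] that by (simp add: B_simps)
  then have "x - y \<in> P" by (simp add: P_def)
  moreover have "x - y \<noteq> 0" using xy(1) by simp
  ultimately show ?thesis using ex_anisotropic[OF P nd, of "x - y"] by (auto simp: P_def)
qed

lemma orthogonal_family_extend:
  assumes v: "orthogonal_family k v" and "k \<le> m" "m \<le> CARD('n)"
  shows "\<exists>w. orthogonal_family m w \<and> (\<forall>i<k. w i = v i)"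
  using assms(2,3)
proof (induction m rule: dec_induct)
  case base
  then show ?case using v by blast
next
  case (step m)
  then obtain w where w: "orthogonal_family m w" "\<forall>i<k. w i = v i" by auto
  obtain u where u: "Q u \<noteq> 0" "\<forall>i<m. B u (w i) = 0"
    using orthogonal_family_extend_one[OF w(1)] step.prems by auto
  have "orthogonal_family (Suc m) (w(m := u))"
    using w(1) u by (auto simp: orthogonal_family_def less_Suc_eq B_sym[of _ u])
  moreover have "\<forall>i<k. (w(m := u)) i = v i" using w(2) step.hyps by auto
  ultimately show ?case by blast
qed

lemma orthogonal_family_exists: "\<exists>v. orthogonal_family CARD('n) v"
  using orthogonal_family_extend[of 0 undefined "CARD('n)"] by (auto simp: orthogonal_family_def)

lemma orthogonal_family_coordinates:
  assumes v: "orthogonal_family CARD('n) v" and e: "bij_betw e {..<CARD('n)} (UNIV :: 'n set)"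
  defines "T \<equiv> \<lambda>x. \<Sum>i<CARD('n). x $ e i *s v i"
  shows "lin T" "bij T"
proof -
  show lin: "lin T"
    unfolding T_def by (rule linI) (simp_all add: scale_simps sum.distrib vec.scale_sum_right)
  have "inj T"
  proof (rule injI)
    fix x y assume "T x = T y"
    then have 0: "T (x - y) = 0" by (simp add: lin_simps[OF lin])
    have "(x - y) $ e i = 0" if "i < CARD('n)" for i
    proof -
      have "(x - y) $ e i * Q (v i) = B (T (x - y)) (v i)"
        unfolding T_def by (rule orthogonal_family_coeff[OF v that, symmetric])
      also have "\<dots> = 0" unfolding 0 by (simp add: B_simps)
      finally show ?thesis using v that unfolding orthogonal_family_def by (metis mult_eq_0_iff)
    qed
    then have "(x - y) $ j = 0" for j
      using bij_betw_imp_surj_on[OF e] by (metis UNIV_I imageE lessThan_iff)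
    then show "x = y" by (simp add: vec_eq_iff)
  qed
  then show "bij T" by (simp add: bij_def finite_UNIV_inj_surj)
qed

lemma lin_ext_orthogonal_family:
  assumes v: "orthogonal_family CARD('n) v" and f: "lin f" and g: "lin g"
    and eq: "\<And>i. i < CARD('n) \<Longrightarrow> f (v i) = g (v i)"
  shows "f x = g x"
proof -
  obtain e where e: "bij_betw e {..<CARD('n)} (UNIV :: 'n set)"
    using ex_bij_betw_nat_finite[of "UNIV :: 'n set"] by (auto simp: atLeast0LessThan)
  obtain a where "x = (\<Sum>i<CARD('n). a $ e i *s v i)"
    using surjD[OF bij_is_surj[OF orthogonal_family_coordinates(2)[OF v e]], of x] by (elim exE)
  then show ?thesis by (simp add: lin_sum[OF f] lin_sum[OF g] lin_scale[OF f] lin_scale[OF g] eq)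
qed

section \<open>Reflections\<close>

definition reflection :: "'a ^ 'n \<Rightarrow> 'a ^ 'n \<Rightarrow> 'a ^ 'n" where
  "reflection u x = x - (2 * B x u / Q u) *s u"

lemma isometry_reflection:
  assumes "Q u \<noteq> 0"
  shows "isometry (reflection u)"
proof (rule isometryI)
  show "lin (reflection u)"
    by (rule linI) (simp_all add: reflection_def scale_simps B_simps add_divide_distrib distrib_left algebra_simps)
  show "B (reflection u x) (reflection u y) = B x y" for x y
    using assms by (simp add: reflection_def B_simps B_self B_sym[of u y] field_simps)
qed

lemma reflection_self: "Q u \<noteq> 0 \<Longrightarrow> reflection u u = - u"
  by (simp add: reflection_def B_self vec_eq_iff)

lemma reflection_orthogonal: "B x u = 0 \<Longrightarrow> reflection u x = x"
  by (simp add: reflection_def)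

lemma reflection_involutive:
  assumes u: "Q u \<noteq> 0"
  shows "reflection u (reflection u x) = x"
proof -
  define a where "a = 2 * B x u / Q u"
  have "reflection u (x - a *s u) = reflection u x - a *s reflection u u"
    by (simp add: lin_simps[OF isometry_lin[OF isometry_reflection[OF u]]])
  also have "\<dots> = x" by (simp add: reflection_self[OF u]) (simp add: reflection_def a_def)
  finally show ?thesis by (simp add: reflection_def[of u x] a_def)
qed

lemma reflection_scale: "a \<noteq> 0 \<Longrightarrow> reflection (a *s u) = reflection u"
  by (auto simp: reflection_def fun_eq_iff B_simps Q_scale power2_eq_square)

lemma reflection_conjugate:
  assumes "isometry f"
  shows "f (reflection u x) = reflection (f u) (f x)"
proof -
  have "Q (f u) = Q u" using assms by (simp add: isometry_def)
  then show ?thesis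
    by (simp add: reflection_def lin_simps[OF isometry_lin[OF assms]] isometry_B[OF assms])
qed

lemma Q_diff: "Q (x - y) = Q x - 2 * B x y + Q y"
  by (simp add: B_simps B_sym[of y x] flip: B_self)

lemma reflection_exchange:
  assumes "Q u = Q w" "Q (u - w) \<noteq> 0"
  shows "reflection (u - w) u = w"
proof -
  have "2 * B u (u - w) = Q (u - w)" using assms by (simp add: Q_diff B_simps B_self)
  then show ?thesis using assms by (simp add: reflection_def)
qed

text \<open>
  The values \<open>Q (u - w)\<close> and \<open>Q (u + w)\<close> add up to \<open>4 Q w\<close>, so they do not both vanish.
\<close>

lemma reflection_exchange_cases:
  assumes Q: "Q u = Q w" "Q w \<noteq> 0"
  obtains "Q (u - w) \<noteq> 0" "reflection (u - w) u = w" | "Q (u + w) \<noteq> 0" "reflection w (reflection (u + w) u) = w"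
proof (cases "Q (u - w) = 0")
  case False
  then show ?thesis using that(1) reflection_exchange Q by blast
next
  case True
  have "Q (u + w) + Q (u - w) = 2 * (2 * Q w)" using Q by (simp add: Q_diff Q_add)
  then have nz: "Q (u + w) \<noteq> 0" using True Q two_neq_0 by (metis add.right_neutral mult_eq_0_iff)
  have "Q (- w) = Q w" using Q_scale[of "-1" w] by simp
  then have "reflection (u + w) u = - w" using reflection_exchange[of u "- w"] Q nz by simp
  then have "reflection w (reflection (u + w) u) = w"
    using reflection_self[OF Q(2)] reflection_involutive[OF Q(2), of w] by simp
  then show ?thesis using that(2) nz by blast
qed

fun reflection_prod :: "('a ^ 'n) list \<Rightarrow> 'a ^ 'n \<Rightarrow> 'a ^ 'n" where
  "reflection_prod [] = id"
| "reflection_prod (u # us) = reflection u \<circ> reflection_prod us"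

lemma isometry_reflection_prod: "\<forall>u\<in>set us. Q u \<noteq> 0 \<Longrightarrow> isometry (reflection_prod us)"
  by (induction us) (auto simp: isometry_id isometry_reflection intro: isometry_comp)

lemma reflection_prod_append: "reflection_prod (us @ ws) = reflection_prod us \<circ> reflection_prod ws"
  by (induction us) auto

lemma reflection_prod_rev: "\<forall>u\<in>set us. Q u \<noteq> 0 \<Longrightarrow> reflection_prod (rev us) (reflection_prod us x) = x"
  by (induction us) (auto simp: reflection_prod_append reflection_involutive)

text \<open>
  By induction along an orthogonal basis the isometry is corrected by at most two reflections at a
  time so that it fixes one more basis vector; the vectors used are orthogonal to those fixed before.
\<close>

lemma isometry_is_reflection_prod:
  assumes f: "isometry f"
  shows "\<exists>us. (\<forall>u\<in>set us. Q u \<noteq> 0) \<and> f = reflection_prod us"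
proof -
  obtain v where v: "orthogonal_family CARD('n) v" using orthogonal_family_exists by blast
  have "\<exists>us. (\<forall>u\<in>set us. Q u \<noteq> 0) \<and> (\<forall>i<k. reflection_prod us (f (v i)) = v i)" if "k \<le> CARD('n)" for k
    using that
  proof (induction k)
    case 0
    show ?case by (intro exI[of _ "[]"]) simp
  next
    case (Suc k)
    then obtain us where us: "\<forall>u\<in>set us. Q u \<noteq> 0" "\<forall>i<k. reflection_prod us (f (v i)) = v i" by auto
    define h where "h = reflection_prod us \<circ> f"
    have h: "isometry h" unfolding h_def by (intro isometry_comp isometry_reflection_prod us f)
    have hv: "h (v i) = v i" if "i < k" for i using us that by (simp add: h_def)
    have Qh: "Q (h (v k)) = Q (v k)" using h by (simp add: isometry_def)
    have nz: "Q (v k) \<noteq> 0" using v Suc.prems by (simp add: orthogonal_family_def)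
    have o1: "B (v i) (v k) = 0" if "i < k" for i
      using v Suc.prems that by (simp add: orthogonal_family_def)
    have o2: "B (v i) (h (v k)) = 0" if "i < k" for i
      using isometry_B[OF h, of "v i" "v k"] hv[OF that] o1[OF that] by simp
    from Qh nz show ?case
    proof (cases rule: reflection_exchange_cases)
      case 1
      have "reflection (h (v k) - v k) (v i) = v i" if "i < k" for i
        using o1 o2 that by (intro reflection_orthogonal) (simp add: B_simps)
      then have "\<forall>i<Suc k. reflection_prod ((h (v k) - v k) # us) (f (v i)) = v i"
        using 1 hv by (auto simp: less_Suc_eq h_def)
      then show ?thesis using us 1 by (intro exI[of _ "(h (v k) - v k) # us"]) simp
    next
      case 2
      have "reflection (h (v k) + v k) (v i) = v i" "reflection (v k) (v i) = v i" if "i < k" for i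
        using o1 o2 that by (simp_all add: reflection_orthogonal B_simps)
      then have "\<forall>i<Suc k. reflection_prod (v k # (h (v k) + v k) # us) (f (v i)) = v i"
        using 2 hv by (auto simp: less_Suc_eq h_def)
      then show ?thesis using us 2 nz by (intro exI[of _ "v k # (h (v k) + v k) # us"]) simp
    qed
  qed
  from this[OF order.refl] obtain us where us: "\<forall>u\<in>set us. Q u \<noteq> 0"
    "\<And>i. i < CARD('n) \<Longrightarrow> reflection_prod us (f (v i)) = v i" by blast
  have "(reflection_prod us \<circ> f) x = id x" for x
    by (rule lin_ext_orthogonal_family[OF v isometry_lin[OF isometry_comp[OF isometry_reflection_prod[OF us(1)] f]]
          isometry_lin[OF isometry_id]]) (simp add: us(2))
  then have "f x = reflection_prod (rev us) x" for x
    using reflection_prod_rev[OF us(1), of "f x"] by simp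
  then show ?thesis using us(1) by (intro exI[of _ "rev us"]) auto
qed

text \<open>
  In an orthogonal basis that begins with \<open>u\<close> the reflection is diagonal.
\<close>

lemma det_reflection:
  assumes u: "Q u \<noteq> 0"
  shows "det (matrix (reflection u)) = -1"
proof -
  have "orthogonal_family 1 (\<lambda>_. u)" using u by (simp add: orthogonal_family_def)
  from orthogonal_family_extend[OF this, of "CARD('n)"]
  obtain v where v: "orthogonal_family CARD('n) v" "v 0 = u" by (auto simp: Suc_le_eq)
  obtain e where e: "bij_betw e {..<CARD('n)} (UNIV :: 'n set)"
    using ex_bij_betw_nat_finite[of "UNIV :: 'n set"] by (auto simp: atLeast0LessThan)
  define T where "T = (\<lambda>x::'a ^ 'n. \<Sum>i<CARD('n). x $ e i *s v i)"
  note T = orthogonal_family_coordinates[OF v(1) e, folded T_def]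
  define D where "D x = (\<chi> j. if j = e 0 then - x $ j else x $ j)" for x :: "'a ^ 'n"
  have linD: "lin D" unfolding D_def by (rule linI) (auto simp: vec_eq_iff)
  note rl = isometry_lin[OF isometry_reflection[OF u]]
  have rv: "reflection u (v i) = (if i = 0 then - v i else v i)" if "i < CARD('n)" for i
    using v that u by (auto simp: orthogonal_family_def reflection_self intro!: reflection_orthogonal)
  have e0: "e i = e 0 \<longleftrightarrow> i = 0" if "i < CARD('n)" for i
    using inj_onD[OF bij_betw_imp_inj_on[OF e], of i 0] that by auto
  have "reflection u (T x) = T (D x)" for x
    unfolding T_def lin_sum[OF rl]
    by (intro sum.cong refl) (auto simp: lin_scale[OF rl] D_def rv e0)
  then have "reflection u \<circ> T = T \<circ> D" by auto
  from arg_cong[OF this, of "\<lambda>f. det (matrix f)"]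
  have "det (matrix (reflection u)) * det (matrix T) = det (matrix T) * det (matrix D)"
    unfolding det_compose[OF rl T(1)] det_compose[OF T(1) linD] .
  moreover have "det (matrix T) \<noteq> 0" using T det_nz_iff_inj_gen by (auto simp: bij_def)
  ultimately have "det (matrix (reflection u)) = det (matrix D)" by (simp add: mult.commute)
  also have "det (matrix D) = -1"
  proof -
    have "det (matrix D) = (\<Prod>i\<in>UNIV. matrix D $ i $ i)"
      by (rule det_diagonal) (auto simp: matrix_def D_def axis_def)
    also have "\<dots> = (\<Prod>i\<in>UNIV. if i = e 0 then -1 else 1)"
      by (intro prod.cong refl) (auto simp: matrix_def D_def axis_def)
    finally show ?thesis by simp
  qed
  finally show ?thesis .
qed

lemma det_reflection_prod:
  "\<forall>u\<in>set us. Q u \<noteq> 0 \<Longrightarrow> det (matrix (reflection_prod us)) = (- 1) ^ length us"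
proof (induction us)
  case Nil
  show ?case unfolding reflection_prod.simps matrix_id_mat_1 by simp
next
  case (Cons u us)
  then show ?case unfolding reflection_prod.simps
    by (subst det_compose) (simp_all add: isometry_lin isometry_reflection isometry_reflection_prod det_reflection)
qed

end

context quadratic_space
begin

section \<open>The orthogonal group modulo its derived subgroup\<close>

abbreviation OG where "OG \<equiv> orthogonal_group Q"
abbreviation DG where "DG \<equiv> derived OG (carrier OG)"

lemma in_OG: "f \<in> carrier OG \<longleftrightarrow> isometry f"
  by (simp add: orthogonal_group_def isometry_def)

lemma OG_simps: "f \<otimes>\<^bsub>OG\<^esub> g = f \<circ> g" "\<one>\<^bsub>OG\<^esub> = id"
  by (simp_all add: orthogonal_group_def)

lemma OG_inv: "isometry f \<Longrightarrow> inv\<^bsub>OG\<^esub> f = inv_map f"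
  by (rule group.inv_equality[OF group_orthogonal_group])
     (auto simp: in_OG OG_simps isometry_inv isometry_inv_simps fun_eq_iff)

lemma derived_isometry: "f \<in> DG \<Longrightarrow> isometry f"
proof -
  have "DG \<subseteq> carrier OG" by (rule group.derived_in_carrier[OF group_orthogonal_group order.refl])
  then show "f \<in> DG \<Longrightarrow> isometry f" by (auto simp: in_OG)
qed

lemma derived_det:
  assumes "f \<in> DG"
  shows "det (matrix f) = 1"
proof -
  have comm: "isometry h \<and> det (matrix h) = 1" if hd: "h \<in> derived_set OG (carrier OG)" for h
  proof -
    obtain a b where "a \<in> carrier OG" "b \<in> carrier OG"
      "h = a \<otimes>\<^bsub>OG\<^esub> b \<otimes>\<^bsub>OG\<^esub> inv\<^bsub>OG\<^esub> a \<otimes>\<^bsub>OG\<^esub> inv\<^bsub>OG\<^esub> b"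
      using hd by blast
    then have ab: "isometry a" "isometry b" "h = a \<circ> b \<circ> inv_map a \<circ> inv_map b"
      by (simp_all add: in_OG OG_simps OG_inv)
    have h: "isometry h" unfolding ab(3) by (intro isometry_comp isometry_inv ab)
    have "det (matrix h) = (det (matrix a) * det (matrix (inv_map a))) * (det (matrix b) * det (matrix (inv_map b)))"
      unfolding ab(3)
      by (subst det_compose isometry_lin isometry_comp isometry_inv ab;
          (intro isometry_lin isometry_comp isometry_inv ab)?)+ (simp only: mult_ac)
    then show ?thesis using h det_isometry_inv(1)[OF ab(1)] det_isometry_inv(1)[OF ab(2)] by simp
  qed
  have "isometry f \<and> det (matrix f) = 1" using assms unfolding derived_def
  proof (induction rule: generate.induct)
    case one
    show ?case unfolding OG_simps by (simp only: isometry_id matrix_id_mat_1 det_I)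
  next
    case (incl h)
    then show ?case by (rule comm)
  next
    case (inv h)
    note h = comm[OF inv]
    then show ?case using isometry_inv[of h] det_isometry_inv(2)[of h] by (simp add: OG_inv)
  next
    case (eng h k)
    then show ?case unfolding OG_simps
      by (subst det_compose) (simp_all add: isometry_lin isometry_comp)
  qed
  then show ?thesis ..
qed

definition cls where "cls f = DG #>\<^bsub>OG\<^esub> f"

definition "AB = OG Mod DG"

lemma comm_group_AB: "comm_group AB"
  unfolding AB_def
  by (rule group.derived_quot_is_comm_group[OF group_orthogonal_group])

lemma normal_DG: "DG \<lhd> OG"
  by (rule group.derived_self_is_normal[OF group_orthogonal_group])

lemma cls_closed: "isometry f \<Longrightarrow> cls f \<in> carrier AB"
  by (auto simp: cls_def AB_def FactGroup_def RCOSETS_def in_OG)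

lemma cls_comp: "isometry f \<Longrightarrow> isometry g \<Longrightarrow> cls (f \<circ> g) = cls f \<otimes>\<^bsub>AB\<^esub> cls g"
  using normal.rcos_sum[OF normal_DG, of f g] by (simp add: cls_def AB_def FactGroup_def in_OG OG_simps)

lemma cls_id: "cls id = \<one>\<^bsub>AB\<^esub>"
proof -
  have "DG \<subseteq> carrier OG"
    by (rule group.derived_in_carrier[OF group_orthogonal_group order.refl])
  then have "DG #>\<^bsub>OG\<^esub> \<one>\<^bsub>OG\<^esub> = DG"
    by (rule group.coset_mult_one[OF group_orthogonal_group])
  then show ?thesis by (simp add: cls_def AB_def FactGroup_def OG_simps)
qed

lemma cls_one_imp:
  assumes "isometry f" "cls f = \<one>\<^bsub>AB\<^esub>"
  shows "f \<in> DG"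
proof -
  have "subgroup DG OG" by (rule group.derived_is_subgroup[OF group_orthogonal_group order.refl])
  then have "f \<in> DG #>\<^bsub>OG\<^esub> f"
    using assms(1) by (intro group.rcos_self[OF group_orthogonal_group]) (simp add: in_OG)
  then show ?thesis using assms(2) by (simp add: cls_def AB_def FactGroup_def)
qed

lemma cls_conjugate:
  assumes f: "isometry f" and g: "isometry g"
  shows "cls (f \<circ> g \<circ> inv_map f) = cls g"
proof -
  interpret AB: comm_group AB by (rule comm_group_AB)
  note f' = isometry_inv[OF f]
  have "f \<circ> inv_map f = id" by (auto simp: isometry_inv_simps[OF f])
  then have 1: "cls f \<otimes>\<^bsub>AB\<^esub> cls (inv_map f) = \<one>\<^bsub>AB\<^esub>" by (metis cls_comp cls_id f f')
  have "cls (f \<circ> g \<circ> inv_map f) = (cls f \<otimes>\<^bsub>AB\<^esub> cls (inv_map f)) \<otimes>\<^bsub>AB\<^esub> cls g"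
    using f g f' by (simp add: cls_comp isometry_comp cls_closed AB.m_ac)
  then show ?thesis using 1 by (simp add: cls_closed g)
qed

lemma cls_reflection_eq:
  assumes u: "Q u \<noteq> 0" and w: "Q w = Q u"
  shows "cls (reflection u) = cls (reflection w)"
proof -
  have Qw: "Q w \<noteq> 0" using u w by simp
  have "\<exists>f. isometry f \<and> f u = w"
    using w[symmetric] Qw
  proof (cases rule: reflection_exchange_cases)
    case 1
    then show ?thesis using isometry_reflection by blast
  next
    case 2
    then show ?thesis
      using isometry_comp[OF isometry_reflection[OF Qw] isometry_reflection[OF 2(1)]]
      by (metis comp_apply)
  qed
  then obtain f where f: "isometry f" "f u = w" by blast
  have "f \<circ> reflection u \<circ> inv_map f = reflection w"
    using reflection_conjugate[OF f(1), of u] by (auto simp: fun_eq_iff f isometry_inv_simps[OF f(1)])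
  then show ?thesis using cls_conjugate[OF f(1) isometry_reflection[OF u]] by simp
qed

text \<open>
  Rescaling a vector changes \<open>Q\<close> by a square and does not change its reflection, and vectors of equal
  value are exchanged by an isometry, which conjugates one reflection into the other.
\<close>

lemma cls_reflection_square_class:
  assumes u: "Q u \<noteq> 0" and w: "Q w \<noteq> 0" and iff: "is_sqr (Q u) \<longleftrightarrow> is_sqr (Q w)"
  shows "cls (reflection u) = cls (reflection w)"
proof -
  obtain c where c: "c \<noteq> 0" "Q w = Q u * (c * c)"
  proof (cases "is_sqr (Q u)")
    case True
    then obtain a b where ab: "Q u = a * a" "Q w = b * b" using iff by (auto simp: is_sqr_def)
    have "b / a \<noteq> 0" "Q w = Q u * (b / a * (b / a))" using u w ab by (auto simp: field_simps)
    then show ?thesis by (rule that)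
  next
    case False
    then show ?thesis using nonsquare_ratio[OF two_neq_0 False] iff that by blast
  qed
  have "Q w = Q (c *s u)" by (simp add: c Q_scale power2_eq_square mult_ac)
  then have "cls (reflection (c *s u)) = cls (reflection w)"
    using cls_reflection_eq[of "c *s u" w] w by simp
  then show ?thesis using reflection_scale[OF c(1)] by simp
qed

definition n_sqr :: "('a ^ 'n) list \<Rightarrow> nat" where
  "n_sqr us = length (filter (\<lambda>u. is_sqr (Q u)) us)"

definition n_nonsqr :: "('a ^ 'n) list \<Rightarrow> nat" where
  "n_nonsqr us = length (filter (\<lambda>u. \<not> is_sqr (Q u)) us)"

lemma length_n_sqr: "length us = n_sqr us + n_nonsqr us"
  by (simp add: n_sqr_def n_nonsqr_def sum_length_filter_compl)

text \<open>
  Classes of reflections are elements of order at most 2 in an abelian group, so only the parities of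
  the numbers of reflections of square and of nonsquare type matter.
\<close>

lemma cls_reflection_prod:
  assumes a: "Q a \<noteq> 0" "is_sqr (Q a)" and b: "Q b \<noteq> 0" "\<not> is_sqr (Q b)"
    and us: "\<forall>u\<in>set us. Q u \<noteq> 0"
  shows "cls (reflection_prod us) =
    (if odd (n_sqr us) then cls (reflection a) else \<one>\<^bsub>AB\<^esub>) \<otimes>\<^bsub>AB\<^esub>
    (if odd (n_nonsqr us) then cls (reflection b) else \<one>\<^bsub>AB\<^esub>)"
  using us
proof (induction us)
  case Nil
  interpret AB: comm_group AB by (rule comm_group_AB)
  show ?case by (simp add: n_sqr_def n_nonsqr_def cls_id del: id_apply)
next
  case (Cons u us)
  interpret AB: comm_group AB by (rule comm_group_AB)
  let ?a = "cls (reflection a)" and ?b = "cls (reflection b)"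
  have cl: "?a \<in> carrier AB" "?b \<in> carrier AB"
    using a b by (simp_all add: cls_closed isometry_reflection)
  have sq: "cls (reflection x) \<otimes>\<^bsub>AB\<^esub> cls (reflection x) = \<one>\<^bsub>AB\<^esub>" if "Q x \<noteq> 0" for x
  proof -
    have "reflection x \<circ> reflection x = id" using reflection_involutive[OF that] by auto
    then show ?thesis by (metis cls_comp cls_id isometry_reflection that)
  qed
  have sq': "?a \<otimes>\<^bsub>AB\<^esub> (?a \<otimes>\<^bsub>AB\<^esub> y) = y" "?b \<otimes>\<^bsub>AB\<^esub> (?b \<otimes>\<^bsub>AB\<^esub> y) = y" if "y \<in> carrier AB" for y
    using that cl sq[OF a(1)] sq[OF b(1)] by (simp_all flip: AB.m_assoc)
  have "cls (reflection_prod (u # us)) = cls (reflection u) \<otimes>\<^bsub>AB\<^esub> cls (reflection_prod us)"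
    unfolding reflection_prod.simps
    by (rule cls_comp) (use Cons.prems in \<open>auto simp: isometry_reflection isometry_reflection_prod\<close>)
  also have "cls (reflection u) = (if is_sqr (Q u) then ?a else ?b)"
    using cls_reflection_square_class[of u a] cls_reflection_square_class[of u b] a b Cons.prems by auto
  also have "cls (reflection_prod us) = (if odd (n_sqr us) then ?a else \<one>\<^bsub>AB\<^esub>) \<otimes>\<^bsub>AB\<^esub>
      (if odd (n_nonsqr us) then ?b else \<one>\<^bsub>AB\<^esub>)"
    using Cons by simp
  finally have step: "cls (reflection_prod (u # us)) = (if is_sqr (Q u) then ?a else ?b) \<otimes>\<^bsub>AB\<^esub>
      ((if odd (n_sqr us) then ?a else \<one>\<^bsub>AB\<^esub>) \<otimes>\<^bsub>AB\<^esub> (if odd (n_nonsqr us) then ?b else \<one>\<^bsub>AB\<^esub>))" .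
  have n: "n_sqr (u # us) = (if is_sqr (Q u) then Suc (n_sqr us) else n_sqr us)"
    "n_nonsqr (u # us) = (if is_sqr (Q u) then n_nonsqr us else Suc (n_nonsqr us))"
    by (simp_all add: n_sqr_def n_nonsqr_def)
  have comm: "?b \<otimes>\<^bsub>AB\<^esub> ?a = ?a \<otimes>\<^bsub>AB\<^esub> ?b" by (rule AB.m_comm[OF cl(2,1)])
  have "?b \<otimes>\<^bsub>AB\<^esub> (?a \<otimes>\<^bsub>AB\<^esub> ?b) = ?a"
    using cl sq'(2)[of ?a] by (simp flip: comm)
  then show ?case
    unfolding step n using cl sq' sq[OF a(1)] sq[OF b(1)] comm by simp
qed

text \<open>
  Here \<open>-1\<close> is the product of the reflections in the family, so its class is \<open>\<alpha> \<beta>\<close>, where \<open>\<alpha>\<close> and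
  \<open>\<beta>\<close> are the classes of reflections of square and of nonsquare type. A product of an even number of
  reflections contains both types equally often modulo 2 and has class \<open>1\<close> or \<open>\<alpha> \<beta>\<close>.
\<close>

lemma derived_or_minus_derived:
  assumes v: "orthogonal_family CARD('n) v" and ev: "even CARD('n)"
    and odd: "odd (card {i \<in> {..<CARD('n)}. \<not> is_sqr (Q (v i))})"
    and s: "isometry s" "det (matrix s) = 1"
  shows "s \<in> DG \<or> (\<lambda>x. - s x) \<in> DG"
proof -
  interpret AB: comm_group AB by (rule comm_group_AB)
  define vs where "vs = map v [0..<CARD('n)]"
  have vs: "\<forall>u\<in>set vs. Q u \<noteq> 0" using v by (auto simp: vs_def orthogonal_family_def)
  have "n_nonsqr vs = card {i \<in> {..<CARD('n)}. \<not> is_sqr (Q (v i))}"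
    by (simp add: n_nonsqr_def vs_def length_filter_map length_filter_conv_card filter_map o_def)
       (rule arg_cong[of _ _ card]; auto)
  then have o1: "odd (n_nonsqr vs)" using odd by simp
  moreover have "even (length vs)" using ev by (simp add: vs_def)
  ultimately have o2: "odd (n_sqr vs)" using length_n_sqr[of vs] by simp
  obtain b where b: "b \<in> set vs" "\<not> is_sqr (Q b)"
    using o1 by (metis (mono_tags, lifting) even_zero filter_False list.size(3) n_nonsqr_def)
  obtain a where a: "a \<in> set vs" "is_sqr (Q a)"
    using o2 by (metis (mono_tags, lifting) even_zero filter_False list.size(3) n_sqr_def)
  note ab = vs[rule_format, OF a(1)] a(2) vs[rule_format, OF b(1)] b(2)
  let ?a = "cls (reflection a)" and ?b = "cls (reflection b)"
  have cl: "?a \<in> carrier AB" "?b \<in> carrier AB"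
    using ab by (simp_all add: cls_closed isometry_reflection)
  have rp: "reflection_prod (map v is) (v i) = (if i \<in> set is then - v i else v i)"
    if "distinct is" "set is \<subseteq> {..<CARD('n)}" "i < CARD('n)" for "is" i
    using that(1,2)
  proof (induction "is")
    case (Cons j js)
    then have IH: "reflection_prod (map v js) (v i) = (if i \<in> set js then - v i else v i)" and j: "j < CARD('n)"
      by auto
    have Qj: "Q (v j) \<noteq> 0" using v j by (simp add: orthogonal_family_def)
    note rl = lin_simps[OF isometry_lin[OF isometry_reflection[OF Qj]]]
    show ?case
    proof (cases "i = j")
      case True
      then show ?thesis using Cons.prems IH Qj by (simp add: reflection_self)
    next
      case False
      then have "reflection (v j) (v i) = v i"
        using v j that(3) by (intro reflection_orthogonal) (simp add: orthogonal_family_def)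
      then show ?thesis using False IH by (simp add: rl)
    qed
  qed simp
  have neg: "isometry (\<lambda>x. - x)" using isometry_uminus[OF isometry_id] by simp
  have "reflection_prod vs x = - x" for x
    by (rule lin_ext_orthogonal_family[OF v isometry_lin[OF isometry_reflection_prod[OF vs]] isometry_lin[OF neg]])
       (simp add: vs_def rp atLeast0LessThan)
  then have "reflection_prod vs = (\<lambda>x. - x)" by auto
  then have cneg: "cls (\<lambda>x. - x) = ?a \<otimes>\<^bsub>AB\<^esub> ?b"
    using cls_reflection_prod[OF ab vs] o1 o2 by simp
  have "(\<lambda>x. - x) \<circ> (\<lambda>x. - x) = (id :: 'a ^ 'n \<Rightarrow> 'a ^ 'n)" by auto
  then have c2: "(?a \<otimes>\<^bsub>AB\<^esub> ?b) \<otimes>\<^bsub>AB\<^esub> (?a \<otimes>\<^bsub>AB\<^esub> ?b) = \<one>\<^bsub>AB\<^esub>"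
    by (metis cls_comp cls_id cneg neg)
  obtain us where us: "\<forall>u\<in>set us. Q u \<noteq> 0" "s = reflection_prod us"
    using isometry_is_reflection_prod[OF s(1)] by blast
  have "(- 1 :: 'a) ^ length us = 1" using det_reflection_prod[OF us(1)] s(2) us(2) by simp
  moreover have "(- 1 :: 'a) \<noteq> 1"
    using two_neq_0 by (metis add.right_inverse one_add_one)
  ultimately have "even (length us)" by (metis power_minus_odd power_one)
  then have "odd (n_sqr us) \<longleftrightarrow> odd (n_nonsqr us)" using length_n_sqr[of us] by simp
  then have "cls s = \<one>\<^bsub>AB\<^esub> \<or> cls s = ?a \<otimes>\<^bsub>AB\<^esub> ?b"
    using cls_reflection_prod[OF ab us(1)] us(2) cl by auto
  then show ?thesis
  proof
    assume "cls s = ?a \<otimes>\<^bsub>AB\<^esub> ?b"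
    then have "cls ((\<lambda>x. - x) \<circ> s) = \<one>\<^bsub>AB\<^esub>" using cls_comp[OF neg s(1)] cneg c2 by simp
    then have "(\<lambda>x. - x) \<circ> s \<in> DG" by (intro cls_one_imp isometry_comp neg s)
    then show ?thesis by (simp add: o_def)
  qed (use cls_one_imp[OF s(1)] in simp)
qed

end

section \<open>The two families of forms\<close>

lemma even_odd_cases_less:
  assumes "even n" "j < (n::nat)"
  obtains k where "k < n div 2" "j = 2 * k" | k where "k < n div 2" "j = 2 * k + 1"
proof (cases "even j")
  case True
  then have "j div 2 < n div 2" "j = 2 * (j div 2)" using assms by presburger+
  then show ?thesis by (rule that(1))
next
  case False
  then have "j div 2 < n div 2" "j = 2 * (j div 2) + 1" using assms by presburger+
  then show ?thesis by (rule that(2))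
qed

context quadratic_space
begin

lemma Q_sum_orthogonal:
  assumes "finite S" "\<And>i j. i \<in> S \<Longrightarrow> j \<in> S \<Longrightarrow> i \<noteq> j \<Longrightarrow> B (y i) (y j) = 0"
  shows "Q (sum y S) = (\<Sum>i\<in>S. Q (y i))"
proof -
  have "Q (sum y S) = (\<Sum>i\<in>S. \<Sum>j\<in>S. B (y i) (y j))"
    by (simp add: B_sum_left flip: B_self) (simp add: B_sum_right)
  also have "\<dots> = (\<Sum>i\<in>S. \<Sum>j\<in>S. if j = i then Q (y i) else 0)"
    using assms by (intro sum.cong refl) (auto simp: B_self)
  finally show ?thesis using assms(1) by simp
qed

text \<open>
  List the vectors with square values before those with nonsquare values. There is an even number of
  each, so consecutive pairs do not straddle the boundary.
\<close>

lemma orthogonal_family_pair_up: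
  assumes v: "orthogonal_family n v" and n: "even n"
    and ev: "even (card {i \<in> {..<n}. \<not> is_sqr (Q (v i))})"
  shows "\<exists>w. orthogonal_family n w \<and> (\<forall>k<n div 2. is_sqr (Q (w (2 * k))) = is_sqr (Q (w (2 * k + 1))))"
proof -
  define S where "S = {i \<in> {..<n}. is_sqr (Q (v i))}"
  define N where "N = {i \<in> {..<n}. \<not> is_sqr (Q (v i))}"
  define m where "m = card S"
  have SN: "S \<union> N = {..<n}" "S \<inter> N = {}" by (auto simp: S_def N_def)
  have fin: "finite S" "finite N" by (auto simp: S_def N_def)
  have card: "m + card N = n"
    using card_Un_disjoint[OF fin SN(2)] by (simp add: SN m_def)
  then have m: "even m" using ev n by (metis N_def even_add)
  obtain f where f: "bij_betw f {..<m} S"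
    using finite_same_card_bij[of "{..<m}" S] fin by (auto simp: m_def)
  obtain g where g: "bij_betw g {m..<n} N"
    using finite_same_card_bij[of "{m..<n}" N] fin card by auto
  define h where "h i = (if i < m then f i else g i)" for i
  have hS: "h i \<in> S" if "i < m" for i using bij_betwE[OF f] that by (simp add: h_def)
  have hN: "h i \<in> N" if "\<not> i < m" "i < n" for i using bij_betwE[OF g] that by (simp add: h_def)
  have h_lt: "h i < n" if "i < n" for i
    using hS[of i] hN[of i] that by (cases "i < m") (auto simp: S_def N_def)
  have inj: "h i \<noteq> h j" if "i < n" "j < n" "i \<noteq> j" for i j
  proof (cases "i < m"; cases "j < m")
    assume "i < m" "j < m"
    then show ?thesis using bij_betw_imp_inj_on[OF f] that by (auto simp: h_def inj_on_def)
  next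
    assume "\<not> i < m" "\<not> j < m"
    then show ?thesis using bij_betw_imp_inj_on[OF g] that by (auto simp: h_def inj_on_def)
  next
    assume "i < m" "\<not> j < m"
    then show ?thesis using hS hN SN(2) that by (metis IntI empty_iff)
  next
    assume "\<not> i < m" "j < m"
    then show ?thesis using hS hN SN(2) that by (metis IntI empty_iff)
  qed
  have "orthogonal_family n (v \<circ> h)"
    using v h_lt inj by (auto simp: orthogonal_family_def)
  moreover have sq: "is_sqr (Q (v (h i))) \<longleftrightarrow> i < m" if "i < n" for i
    using hS[of i] hN[of i] that by (cases "i < m") (auto simp: S_def N_def)
  have "is_sqr (Q ((v \<circ> h) (2 * k))) = is_sqr (Q ((v \<circ> h) (2 * k + 1)))" if "k < n div 2" for k
  proof -
    have "2 * k < n" "2 * k + 1 < n" using that n by presburger+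
    moreover have "2 * k < m \<longleftrightarrow> 2 * k + 1 < m" using m by presburger
    ultimately show ?thesis using sq[of "2 * k"] sq[of "2 * k + 1"] by simp
  qed
  ultimately show ?thesis by blast
qed

lemma plus_type_if_hyperbolic_pairs:
  assumes n: "even CARD('n)"
    and f0: "\<And>k. k < CARD('n) div 2 \<Longrightarrow> Q (f k) = 0 \<and> Q (g k) = 0 \<and> 2 * B (f k) (g k) = 1"
    and orth: "\<And>k l. k < CARD('n) div 2 \<Longrightarrow> l < CARD('n) div 2 \<Longrightarrow> k \<noteq> l \<Longrightarrow>
      B (f k) (f l) = 0 \<and> B (f k) (g l) = 0 \<and> B (g k) (g l) = 0"
  shows "plus_type Q"
proof -
  let ?r = "CARD('n) div 2"
  obtain e where e: "bij_betw e {..<CARD('n)} (UNIV :: 'n set)"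
    using ex_bij_betw_nat_finite[of "UNIV :: 'n set"] by (auto simp: atLeast0LessThan)
  define y where "y x k = x $ e (2 * k) *s f k + x $ e (2 * k + 1) *s g k" for x k
  define T where "T x = (\<Sum>k<?r. y x k)" for x
  have lin: "lin T"
    unfolding T_def y_def by (rule linI) (simp_all add: scale_simps sum.distrib vec.scale_sum_right)
  have orth': "B (g k) (f l) = 0" if "k < ?r" "l < ?r" "k \<noteq> l" for k l
    using orth[of l k] that by (simp add: B_sym)
  have Qy: "Q (y x k) = x $ e (2 * k) * x $ e (2 * k + 1)" if "k < ?r" for x k
  proof -
    have "Q (y x k) = x $ e (2 * k) * x $ e (2 * k + 1) * (2 * B (f k) (g k))"
      using f0[OF that] by (simp add: y_def Q_add Q_scale B_simps mult_ac)
    then show ?thesis using f0[OF that] by simp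
  qed
  have "Q (T x) = hyperbolic_form e x" for x
    unfolding T_def hyperbolic_form_def
    by (subst Q_sum_orthogonal) (auto simp: Qy, auto simp: y_def B_simps orth orth')
  moreover have "inj T"
  proof (rule injI)
    fix a b assume ab: "T a = T b"
    define x where "x = a - b"
    have 0: "T x = 0" using ab by (simp add: x_def lin_simps[OF lin])
    have coord: "x $ e (2 * k) = 0" "x $ e (2 * k + 1) = 0" if k: "k < ?r" for k
    proof -
      have yg: "B (y x l) (g k) = (if l = k then x $ e (2 * k) * B (f k) (g k) else 0)" if "l < ?r" for l
        using f0[OF k] orth[OF that k] that by (auto simp: y_def B_simps B_self)
      have yf: "B (y x l) (f k) = (if l = k then x $ e (2 * k + 1) * B (f k) (g k) else 0)" if "l < ?r" for l
        using f0[OF k] orth[OF that k] orth'[OF that k] that by (auto simp: y_def B_simps B_self B_sym[of "g k" "f k"])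
      have nz: "B (f k) (g k) \<noteq> 0" using f0[OF k] by auto
      have "B (T x) (g k) = x $ e (2 * k) * B (f k) (g k)"
        unfolding T_def B_sum_left using k by (simp add: yg)
      then show "x $ e (2 * k) = 0" using nz by (simp add: 0 B_simps)
      have "B (T x) (f k) = x $ e (2 * k + 1) * B (f k) (g k)"
        unfolding T_def B_sum_left using k by (simp add: yf)
      then show "x $ e (2 * k + 1) = 0" using nz by (simp add: 0 B_simps)
    qed
    have "x $ e j = 0" if "j < CARD('n)" for j
      using n that by (rule even_odd_cases_less) (use coord in auto)
    then have "x $ i = 0" for i
      using bij_betw_imp_surj_on[OF e] by (metis UNIV_I imageE lessThan_iff)
    then have "x = 0" by (simp add: vec_eq_iff)
    then show "a = b" by (simp add: x_def)
  qed
  ultimately have "equivalent_forms Q (hyperbolic_form e)"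
    unfolding equivalent_forms_def using lin
    by (intro exI[of _ T]) (simp add: bij_def finite_UNIV_inj_surj)
  then show ?thesis
    unfolding plus_type_def using n e quadratic nondegenerate by blast
qed

text \<open>
  With \<open>\<iota>\<^sup>2 = -1\<close> and two orthogonal vectors \<open>p\<close>, \<open>p'\<close> of equal value, \<open>p + \<iota> p'\<close> and \<open>p - \<iota> p'\<close> are
  isotropic; after rescaling they form a hyperbolic pair.
\<close>

lemma plus_type_if_even_nonsquares:
  assumes v: "orthogonal_family CARD('n) v" and n: "even CARD('n)"
    and ev: "even (card {i \<in> {..<CARD('n)}. \<not> is_sqr (Q (v i))})" and sq: "is_sqr (-1 :: 'a)"
  shows "plus_type Q"
proof -
  let ?r = "CARD('n) div 2"
  obtain \<iota> where \<iota>: "\<iota> * \<iota> = (-1 :: 'a)" using sq by (auto simp: is_sqr_def)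
  obtain w where w: "orthogonal_family CARD('n) w"
    "\<forall>k<?r. is_sqr (Q (w (2 * k))) = is_sqr (Q (w (2 * k + 1)))"
    using orthogonal_family_pair_up[OF v n ev] by blast
  have lt: "2 * k < CARD('n)" "2 * k + 1 < CARD('n)" if "k < ?r" for k using that n by presburger+
  have Qw: "Q (w (2 * k)) \<noteq> 0" "Q (w (2 * k + 1)) \<noteq> 0" if "k < ?r" for k
    using w(1) lt[OF that] by (auto simp: orthogonal_family_def)
  have "\<exists>c. c \<noteq> 0 \<and> Q (w (2 * k)) = c\<^sup>2 * Q (w (2 * k + 1))" if k: "k < ?r" for k
  proof (cases "is_sqr (Q (w (2 * k)))")
    case True
    then obtain a b where ab: "Q (w (2 * k)) = a * a" "Q (w (2 * k + 1)) = b * b"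
      using w(2) k by (auto simp: is_sqr_def)
    show ?thesis
      using Qw[OF k] ab by (intro exI[of _ "a / b"]) (auto simp: power2_eq_square)
  next
    case False
    then obtain c where c: "c \<noteq> 0" "Q (w (2 * k)) = Q (w (2 * k + 1)) * (c * c)"
      using nonsquare_ratio[OF two_neq_0, of "Q (w (2 * k + 1))" "Q (w (2 * k))"] w(2) k by auto
    then show ?thesis by (intro exI[of _ c]) (simp add: power2_eq_square mult_ac)
  qed
  then obtain c where c: "\<And>k. k < ?r \<Longrightarrow> c k \<noteq> 0 \<and> Q (w (2 * k)) = (c k)\<^sup>2 * Q (w (2 * k + 1))" by metis
  define p where "p k = w (2 * k)" for k
  \<comment> \<open>The factor \<open>c k\<close> equalises the two values of the pair, and \<open>\<iota>\<close> changes the sign of the second.\<close>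
  define q where "q k = (\<iota> * c k) *s w (2 * k + 1)" for k
  have Qp: "Q (p k) \<noteq> 0" if "k < ?r" for k using Qw that by (simp add: p_def)
  have i2: "\<iota>\<^sup>2 = -1" using \<iota> by (simp add: power2_eq_square)
  have Qq: "Q (q k) = - Q (p k)" if "k < ?r" for k
    using c[OF that] by (simp add: p_def q_def Q_scale power_mult_distrib i2)
  have pq: "B (p k) (p l) = 0 \<and> B (q k) (q l) = 0" if "k < ?r" "l < ?r" "k \<noteq> l" for k l
  proof -
    have "2 * k \<noteq> 2 * l" "2 * k + 1 \<noteq> 2 * l + 1" using that(3) by auto
    then show ?thesis
      using w(1) lt[OF that(1)] lt[OF that(2)] unfolding orthogonal_family_def p_def q_def by (simp add: B_simps)
  qed
  have pq': "B (p k) (q l) = 0" if "k < ?r" "l < ?r" for k l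
  proof -
    have "2 * k \<noteq> 2 * l + 1" by presburger
    then show ?thesis
      using w(1) lt[OF that(1)] lt[OF that(2)] unfolding orthogonal_family_def p_def q_def by (simp add: B_simps)
  qed
  define f where "f k = p k + q k" for k
  define g where "g k = (1 / (2 * (2 * Q (p k)))) *s (p k - q k)" for k
  show ?thesis
  proof (rule plus_type_if_hyperbolic_pairs[OF n, of f g])
    fix k assume k: "k < ?r"
    have eq: "B (f k) (p k - q k) = 2 * Q (p k)"
      using pq'[OF k k] by (simp add: f_def B_simps B_self B_sym[of "q k" "p k"] Qq[OF k])
    have nz: "2 * (2 * Q (p k)) \<noteq> 0" using Qp[OF k] two_neq_0 by (simp only: mult_eq_0_iff) simp
    have inverse: "1 / K * K = 1" if "K \<noteq> 0" for K :: 'a using that by simp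
    have "2 * B (f k) (g k) = 2 * (1 / (2 * (2 * Q (p k))) * (2 * Q (p k)))"
      by (simp only: g_def B_scale_right eq)
    also have "\<dots> = 1 / (2 * (2 * Q (p k))) * (2 * (2 * Q (p k)))" by (rule mult.left_commute)
    also have "\<dots> = 1" by (rule inverse[OF nz])
    finally have "2 * B (f k) (g k) = 1" .
    then show "Q (f k) = 0 \<and> Q (g k) = 0 \<and> 2 * B (f k) (g k) = 1"
      using pq'[OF k k] by (simp add: f_def g_def Q_scale Q_add Q_diff Qq[OF k])
  next
    fix k l assume kl: "k < ?r" "l < ?r" "k \<noteq> l"
    have "B (q k) (p l) = 0" using pq'[OF kl(2,1)] by (simp add: B_sym)
    then show "B (f k) (f l) = 0 \<and> B (f k) (g l) = 0 \<and> B (g k) (g l) = 0"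
      using pq[OF kl] pq'[OF kl(1,2)] by (simp add: f_def g_def B_simps)
  qed
qed

text \<open>
  The sum and the difference of the two vectors of a hyperbolic pair are orthogonal with values \<open>1\<close>
  and \<open>-1\<close>.
\<close>

lemma plus_type_orthogonal_family:
  assumes plus: "plus_type Q" and nsq: "\<not> is_sqr (-1 :: 'a)" and r: "odd (CARD('n) div 2)"
  shows "\<exists>v. orthogonal_family CARD('n) v \<and> odd (card {i \<in> {..<CARD('n)}. \<not> is_sqr (Q (v i))})"
proof -
  let ?r = "CARD('n) div 2"
  have n: "even CARD('n)" using plus by (simp add: plus_type_def)
  obtain e T where e: "bij_betw e {..<CARD('n)} (UNIV :: 'n set)"
    and T: "lin T" "\<And>x. Q (T x) = hyperbolic_form e x"
    using plus by (auto simp: plus_type_def equivalent_forms_def)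
  have lt: "2 * k < CARD('n)" "2 * k + 1 < CARD('n)" if "k < ?r" for k using that n by presburger+
  have e_eq: "e i = e j \<longleftrightarrow> i = j" if "i < CARD('n)" "j < CARD('n)" for i j
    using bij_betw_imp_inj_on[OF e] that by (auto simp: inj_on_def)
  have BT: "2 * B (T x) (T y) = (\<Sum>k<?r. x $ e (2 * k) * y $ e (2 * k + 1) + x $ e (2 * k + 1) * y $ e (2 * k))" for x y
  proof -
    have "2 * B (T x) (T y) = Q (T (x + y)) - Q (T x) - Q (T y)"
      using two_neq_0 by (simp add: assoc_form_def lin_simps[OF T(1)])
    then show ?thesis
      by (simp add: T(2) hyperbolic_form_def algebra_simps flip: sum_subtractf sum.distrib)
  qed
  define p where "p k = T (axis (e (2 * k)) 1)" for k
  define q where "q k = T (axis (e (2 * k + 1)) 1)" for k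
  have ax: "axis (e i) (1::'a) $ e j = (if i = j then 1 else 0)" if "i < CARD('n)" "j < CARD('n)" for i j
    using e_eq[OF that] by (auto simp: axis_def)
  have "2 * B (p k) (p l) = 0" if "k < ?r" "l < ?r" for k l
    unfolding p_def BT using lt that by (intro sum.neutral) (auto simp: ax; presburger)
  then have pp: "B (p k) (p l) = 0" if "k < ?r" "l < ?r" for k l using two_neq_0 that by simp
  have "2 * B (q k) (q l) = 0" if "k < ?r" "l < ?r" for k l
    unfolding q_def BT using lt that by (intro sum.neutral) (auto simp: ax; presburger)
  then have qq: "B (q k) (q l) = 0" if "k < ?r" "l < ?r" for k l using two_neq_0 that by simp
  have pq: "2 * B (p k) (q l) = (if k = l then 1 else 0)" if "k < ?r" "l < ?r" for k l
  proof -
    have "2 * B (p k) (q l) = (\<Sum>j<?r. if j = k then if k = l then 1 else 0 else 0)"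
      unfolding p_def q_def BT
    proof (intro sum.cong refl)
      fix j assume "j \<in> {..<?r}"
      then have j: "j < ?r" by simp
      have "2 * k \<noteq> 2 * j + 1" "2 * l + 1 \<noteq> 2 * j" by presburger+
      then show "axis (e (2 * k)) 1 $ e (2 * j) * axis (e (2 * l + 1)) 1 $ e (2 * j + 1) +
          axis (e (2 * k)) 1 $ e (2 * j + 1) * axis (e (2 * l + 1)) 1 $ e (2 * j) =
          (if j = k then if k = l then 1 else 0 else (0::'a))"
        using lt[OF j] lt[OF that(1)] lt[OF that(2)] by (auto simp: ax)
    qed
    then show ?thesis using that by simp
  qed
  have pq0: "B (p k) (q l) = 0" if "k < ?r" "l < ?r" "k \<noteq> l" for k l
    using pq[OF that(1,2)] that(3) two_neq_0 by simp
  define v where "v i = (if even i then p (i div 2) + q (i div 2) else p (i div 2) - q (i div 2))" for i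
  have Qv: "Q (v i) = (if even i then 1 else -1)" if "i < CARD('n)" for i
  proof -
    have k: "i div 2 < ?r" using that n by presburger
    have "Q (p (i div 2)) = 0" "Q (q (i div 2)) = 0"
      using pp[OF k k] qq[OF k k] by (simp_all add: B_self)
    then show ?thesis using pq[OF k k] by (simp add: v_def Q_add Q_diff)
  qed
  have Bv: "B (v i) (v j) = 0" if ij: "i < CARD('n)" "j < CARD('n)" "i \<noteq> j" for i j
  proof -
    have k: "i div 2 < ?r" "j div 2 < ?r" using ij(1,2) n by presburger+
    note z = pp[OF k] qq[OF k] B_sym[of "q (i div 2)" "p (j div 2)"]
    show ?thesis
    proof (cases "i div 2 = j div 2")
      case True
      then have "even i \<noteq> even j" using ij(3) by presburger
      then show ?thesis using z True by (auto simp: v_def B_simps)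
    next
      case False
      then show ?thesis using z pq0[OF k] pq0[OF k(2,1)] by (auto simp: v_def B_simps)
    qed
  qed
  have "orthogonal_family CARD('n) v"
    unfolding orthogonal_family_def by (auto simp: Qv Bv)
  moreover have sq1: "is_sqr (1::'a)" unfolding is_sqr_def by (rule exI[of _ 1]) simp
  have "{i \<in> {..<CARD('n)}. \<not> is_sqr (Q (v i))} = (\<lambda>k. 2 * k + 1) ` {..<?r}"
  proof (intro subset_antisym subsetI)
    fix i assume i: "i \<in> {i \<in> {..<CARD('n)}. \<not> is_sqr (Q (v i))}"
    then have "i < CARD('n)" by simp
    with n show "i \<in> (\<lambda>k. 2 * k + 1) ` {..<?r}"
    proof (cases rule: even_odd_cases_less)
      case (1 k)
      then have "is_sqr (Q (v i))" using Qv[of i] i sq1 by simp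
      then show ?thesis using i by simp
    qed auto
  qed (use nsq Qv lt in auto)
  then have "card {i \<in> {..<CARD('n)}. \<not> is_sqr (Q (v i))} = ?r"
    by (simp add: card_image inj_on_def)
  ultimately show ?thesis using r by auto
qed

end

theorem proposition3p1:
  fixes m q :: nat
    and Q :: "('a::{field, finite}) ^ ('n::finite) \<Rightarrow> 'a"
  assumes "m \<ge> 1"
    and "odd q"
    and "CARD('a) = q"
    and "CARD('n) = 4 * m + 2"
    and "(minus_type Q \<and> q mod 4 = 1) \<or> (plus_type Q \<and> q mod 4 = 3)"
  shows "\<forall>C \<in> conjugacy_classes (Omega Q).
           real_class (Omega Q) C \<longrightarrow> strongly_real_class (Omega Q) C"
proof -
  have odd: "odd CARD('a)" using assms(2,3) by simp
  interpret quadratic_space Q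
    using assms(5) two_neq_0_if_odd_card[OF odd]
    by unfold_locales (auto simp: minus_type_def plus_type_def)
  have "CARD('n) div 2 = 2 * m + 1" using assms(4) by simp
  then have n: "even CARD('n)" "odd (CARD('n) div 2)" using assms(4) by simp_all
  obtain v where v: "orthogonal_family CARD('n) v" "odd (card {i \<in> {..<CARD('n)}. \<not> is_sqr (Q (v i))})"
    using assms(5)
  proof (elim disjE conjE)
    assume mt: "minus_type Q" "q mod 4 = 1"
    obtain v where v: "orthogonal_family CARD('n) v" using orthogonal_family_exists by blast
    have "is_sqr (-1 :: 'a)" using is_sqr_minus_1_iff[OF odd] mt(2) assms(3) by simp
    then show thesis
      using that v mt(1) plus_type_if_even_nonsquares[OF v n(1)] by (auto simp: minus_type_def)
  next
    assume pt: "plus_type Q" "q mod 4 = 3"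
    have "\<not> is_sqr (-1 :: 'a)" using is_sqr_minus_1_iff[OF odd] pt(2) assms(3) by simp
    then show thesis using that plus_type_orthogonal_family[OF pt(1) _ n(2)] by blast
  qed
  interpret O: group "Omega Q" by (rule group_Omega)
  have car: "carrier (Omega Q) = DG" by (simp add: Omega_def)
  have mult: "f \<otimes>\<^bsub>Omega Q\<^esub> g = f \<circ> g" and one: "\<one>\<^bsub>Omega Q\<^esub> = id" for f g
    by (simp_all add: Omega_def orthogonal_group_def)
  have main: "is_strongly_real_in (Omega Q) g" if g: "g \<in> carrier (Omega Q)" and real: "is_real_in (Omega Q) g" for g
  proof -
    obtain h where h: "h \<in> carrier (Omega Q)" "h \<otimes>\<^bsub>Omega Q\<^esub> g \<otimes>\<^bsub>Omega Q\<^esub> inv\<^bsub>Omega Q\<^esub> h = inv\<^bsub>Omega Q\<^esub> g"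
      using real by (auto simp: is_real_in_def)
    have "g \<otimes>\<^bsub>Omega Q\<^esub> (h \<otimes>\<^bsub>Omega Q\<^esub> g) = h"
    proof -
      have "h \<otimes>\<^bsub>Omega Q\<^esub> g = inv\<^bsub>Omega Q\<^esub> g \<otimes>\<^bsub>Omega Q\<^esub> h"
        using h g by (metis O.inv_closed O.inv_solve_right O.m_closed)
      then show ?thesis using h g by (simp flip: O.m_assoc)
    qed
    then have ghg: "g (h (g x)) = h x" for x by (auto simp: mult fun_eq_iff)
    have gi: "isometry g" and hi: "isometry h" "det (matrix h) = 1"
      using g h(1) derived_isometry derived_det by (auto simp: car)
    obtain s where s: "isometry s" "\<And>x. s (s x) = x" "\<And>x. g (s (g x)) = s x" "det (matrix s) = 1"
      using special_inverting_involution[OF gi hi ghg] by blast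
    have strong: "is_strongly_real_in (Omega Q) g"
      if t: "t \<in> DG" "\<And>x. t (t x) = x" "\<And>x. g (t (g x)) = t x" for t
    proof -
      have tc: "t \<in> carrier (Omega Q)" unfolding car by (rule t(1))
      have tt: "t \<otimes>\<^bsub>Omega Q\<^esub> t = \<one>\<^bsub>Omega Q\<^esub>" using t(2) by (auto simp: mult one)
      have "g \<otimes>\<^bsub>Omega Q\<^esub> (t \<otimes>\<^bsub>Omega Q\<^esub> g \<otimes>\<^bsub>Omega Q\<^esub> t) = \<one>\<^bsub>Omega Q\<^esub>"
        using t(2,3) by (auto simp: mult one fun_eq_iff)
      then have "t \<otimes>\<^bsub>Omega Q\<^esub> g \<otimes>\<^bsub>Omega Q\<^esub> t = inv\<^bsub>Omega Q\<^esub> g"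
        using g tc by (metis O.inv_equality O.inv_inv O.inv_closed O.m_closed)
      moreover have "inv\<^bsub>Omega Q\<^esub> t = t" by (rule O.inv_equality[OF tt tc tc])
      moreover have "t [^]\<^bsub>Omega Q\<^esub> (2::nat) = \<one>\<^bsub>Omega Q\<^esub>"
        using tc tt by (simp add: numeral_2_eq_2)
      ultimately show ?thesis unfolding is_strongly_real_in_def using tc by auto
    qed
    from derived_or_minus_derived[OF v(1) n(1) v(2) s(1,4)] show ?thesis
    proof
      assume "s \<in> DG"
      then show ?thesis using s(2,3) by (rule strong)
    next
      assume "(\<lambda>x. - s x) \<in> DG"
      then show ?thesis
        by (rule strong) (simp_all add: s(2,3) lin_simps[OF isometry_lin[OF s(1)]] lin_simps[OF isometry_lin[OF gi]])
    qed
  qed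
  show ?thesis
  proof (intro ballI impI)
    fix C assume C: "C \<in> conjugacy_classes (Omega Q)" "real_class (Omega Q) C"
    have "C \<subseteq> carrier (Omega Q)"
      using C(1) by (auto simp: conjugacy_classes_def conjugacy_class_def)
    then show "strongly_real_class (Omega Q) C"
      using C(2) main by (auto simp: strongly_real_class_def real_class_def)
  qed
qed

end
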